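(* Let $A\subset C$ and $B\subset D$ be unital inclusions of unital $C^*$-algebras which are strongly Morita equivalent with respect to a $C-D$-equivalence bimodule $Y$ and its closed subspace $X$. Let $E^A:C\to A$ and $E^B:D\to B$ be conditional expectations of Watatani index-finite type and let $E^X$ be a conditional expectation from $Y$ onto $X$ with respect to $E^A$ and $E^B$. Let $C_1$, $D_1$ be the $C^*$-basic constructions for $E^A$, $E^B$, let $E^C:C_1\to C$, $E^D:D_1\to D$ be the dual conditional expectations of $E^A$, $E^B$, and let $Y_1=C\otimes_A X\otimes_B\widetilde{D}$, in which $Y$ is regarded as a closed subspace via $\phi(y)=\sum_{i,j}u_i\otimes E^X(u_i^*\cdot y\cdot v_j)\otimes\widetilde{v_j}$, where $\{(u_i,u_i^* )\}$, $\{(v_j,v_j^* )\}$ are quasi-bases for $E^A$, $E^B$. Let $E^Y:Y_1\to Y$ be the linear map defined by $$E^Y(c\otimes x\otimes\widetilde d)=\mathrm{Ind}_W(E^A)^{-1}c\cdot x\cdot d^*\qquad(c\in C,\ d\in D,\ x\in X).$$ Then $E^Y$ is a conditional expectation from $Y_1$ onto $Y$ with respect to $E^C$ and $E^D$.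
   Context: Equivalence bimodules are imprimitivity bimodules; actions are written $c\cdot y$, $y\cdot d$; ${}_C\langle\ ,\ \rangle$ (linear in the first variable) and $\langle\ ,\ \rangle_D$ (linear in the second variable) are the inner products. For sets, $\langle U,V\rangle$ means the linear span of the inner products. Strong Morita equivalence of inclusions: unital inclusions $A\subset C$, $B\subset D$ are strongly Morita equivalent with respect to a $C-D$-equivalence bimodule $Y$ and its closed subspace $X$ if (1) $a\cdot x\in X$ and ${}_C\langle x,y\rangle\in A$ for $a\in A$, $x,y\in X$, and $\overline{{}_C\langle X,X\rangle}=A$, $\overline{{}_C\langle Y,X\rangle}=C$; (2) $x\cdot b\in X$ and $\langle x,y\rangle_D\in B$ for $b\in B$, $x,y\in X$, and $\overline{\langle X,X\rangle_D}=B$, $\overline{\langle Y,X\rangle_D}=D$. Then $X$ is an $A-B$-equivalence bimodule. In that situation a linear map $E^X$ from $Y$ onto $X$ is a conditional expectation with respect to $E^A$ and $E^B$ if, for all $a\in A,b\in B,c\in C,d\in D,x\in X,y\in Y$: $E^X(c\cdot x)=E^A(c)\cdot x$; $E^X(a\cdot y)=a\cdot E^X(y)$; $E^A({}_C\langle y,x\rangle)={}_C\langle E^X(y),x\rangle$; $E^X(x\cdot d)=x\cdot E^B(d)$; $E^X(y\cdot b)=E^X(y)\cdot b$; $E^B(\langle y,x\rangle_D)=\langle E^X(y),x\rangle_D$. The same definition is applied to $C\subset C_1$, $D\subset D_1$, which are strongly Morita equivalent with respect to $Y_1$ and its closed subspace $\phi(Y)\cong Y$. $E^A$ is of Watatani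 index-finite type if it has a quasi-basis: a finite family $\{(u_i,u_i^* )\}$ with $u_i\in C$ and $\sum_i u_iE^A(u_i^*c)=c=\sum_i E^A(cu_i)u_i^*$ for all $c\in C$; then $\mathrm{Ind}_W(E^A)=\sum_i u_iu_i^*\in C\cap C'$, which is positive, invertible and independent of the quasi-basis. The $C^*$-basic construction $C_1$ for $E^A$, with Jones projection $e_A$, is the linear span of $\{c_1e_Ac_2: c_1,c_2\in C\}$, where $e_Ace_A=E^A(c)e_A$; the dual conditional expectation is $E^C(c_1e_Ac_2)=\mathrm{Ind}_W(E^A)^{-1}c_1c_2$. $C$ is a $C_1-A$-equivalence bimodule via ${}_{C_1}\langle x,y\rangle=xe_Ay^*$, $\langle x,y\rangle_A=E^A(x^*y)$, $(xe_Ay)\cdot z=xE^A(yz)$, $x\cdot a=xa$. Likewise for $D_1$, $e_B$, $E^D$; $D$ is a $D_1-B$-equivalence bimodule and $\widetilde{D}=\{\widetilde d: d\in D\}$ is its dual $B-D_1$-equivalence bimodule. The map $\phi$ is $C-D$-bilinear, preserves inner products, and does not depend on the choice of quasi-bases. ($E^Y$ is well defined.) *)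

theory Defs
  imports "HOL-Analysis.Analysis" "HOL-Library.Function_Algebras"
begin

section \<open>Complex vector spaces and unital \<open>C\<^sup>*\<close>-algebras\<close>

class scaleC =
  fixes scaleC :: "complex \<Rightarrow> 'a \<Rightarrow> 'a"  (infixr \<open>*\<^sub>C\<close> 75)

class complex_vector = scaleC + ab_group_add +
  assumes scaleC_add_right: "r *\<^sub>C (x + y) = r *\<^sub>C x + r *\<^sub>C y"
    and scaleC_add_left: "(r + s) *\<^sub>C x = r *\<^sub>C x + s *\<^sub>C x"
    and scaleC_scaleC: "r *\<^sub>C s *\<^sub>C x = (r * s) *\<^sub>C x"
    and scaleC_one: "1 *\<^sub>C x = x"

global_interpretation complex_vector:
  vector_space "scaleC :: complex \<Rightarrow> 'a \<Rightarrow> 'a::complex_vector"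
  defines csubspace = complex_vector.subspace
    and cspan = complex_vector.span
  by unfold_locales (fact scaleC_add_right scaleC_add_left scaleC_scaleC scaleC_one)+

text \<open>Linearity of a map on a subspace; nothing is said outside of it.\<close>

definition clinear_on :: "'a::complex_vector set \<Rightarrow> ('a \<Rightarrow> 'b::complex_vector) \<Rightarrow> bool" where
  "clinear_on S f \<longleftrightarrow>
     (\<forall>x\<in>S. \<forall>y\<in>S. f (x + y) = f x + f y) \<and> (\<forall>r. \<forall>x\<in>S. f (r *\<^sub>C x) = r *\<^sub>C f x)"

instantiation "fun" :: (type, complex_vector) complex_vector
begin
definition scaleC_fun :: "complex \<Rightarrow> ('a \<Rightarrow> 'b) \<Rightarrow> 'a \<Rightarrow> 'b" where
  "scaleC_fun r f = (\<lambda>x. r *\<^sub>C f x)"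
instance
  by standard
    (simp_all add: scaleC_fun_def fun_eq_iff scaleC_add_right scaleC_add_left scaleC_scaleC scaleC_one)
end

class cstar_algebra = complex_vector + real_normed_algebra_1 + banach +
  fixes star :: "'a \<Rightarrow> 'a"
  assumes scaleR_scaleC: "a *\<^sub>R x = complex_of_real a *\<^sub>C x"
    and scaleC_mult_left: "(r *\<^sub>C x) * y = r *\<^sub>C (x * y)"
    and scaleC_mult_right: "x * (r *\<^sub>C y) = r *\<^sub>C (x * y)"
    and norm_scaleC: "norm (r *\<^sub>C x) = cmod r * norm x"
    and star_star: "star (star x) = x"
    and star_add: "star (x + y) = star x + star y"
    and star_scaleC: "star (r *\<^sub>C x) = cnj r *\<^sub>C star x"
    and star_mult: "star (x * y) = star y * star x"
    and norm_star_mult: "norm (star x * x) = (norm x)\<^sup>2"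

definition unital_cstar_subalgebra :: "'c::cstar_algebra set \<Rightarrow> bool" where
  "unital_cstar_subalgebra A \<longleftrightarrow>
     csubspace A \<and> closed A \<and> 1 \<in> A \<and>
     (\<forall>a\<in>A. \<forall>b\<in>A. a * b \<in> A) \<and> (\<forall>a\<in>A. star a \<in> A)"

section \<open>Hilbert modules and equivalence bimodules\<close>

text \<open>The algebras acting on bimodules are given by their carriers and operations, so that
  subalgebras and algebras of operators can be used as coefficients. Addition and scalar
  multiplication are those of the ambient complex vector space.\<close>

record 'a star_alg =
  acar :: "'a set"
  amult :: "'a \<Rightarrow> 'a \<Rightarrow> 'a"
  aone :: 'a
  astar :: "'a \<Rightarrow> 'a"
  anorm :: "'a \<Rightarrow> real"

definition sub_alg :: "'c::cstar_algebra set \<Rightarrow> 'c star_alg" where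
  "sub_alg A = \<lparr>acar = A, amult = (*), aone = 1, astar = star, anorm = norm\<rparr>"

definition positive_in :: "'a star_alg \<Rightarrow> 'a \<Rightarrow> bool" where
  "positive_in R a \<longleftrightarrow> (\<exists>b\<in>acar R. a = amult R (astar R b) b)"

record ('l, 'r, 'y) bimodule =
  lalg :: "'l star_alg"
  ralg :: "'r star_alg"
  bcar :: "'y set"
  lact :: "'l \<Rightarrow> 'y \<Rightarrow> 'y"
  ract :: "'y \<Rightarrow> 'r \<Rightarrow> 'y"
  linner :: "'y \<Rightarrow> 'y \<Rightarrow> 'l"
  rinner :: "'y \<Rightarrow> 'y \<Rightarrow> 'r"

definition lnorm :: "('l, 'r, 'y) bimodule \<Rightarrow> 'y \<Rightarrow> real" where
  "lnorm M x = sqrt (anorm (lalg M) (linner M x x))"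

definition rnorm :: "('l, 'r, 'y) bimodule \<Rightarrow> 'y \<Rightarrow> real" where
  "rnorm M x = sqrt (anorm (ralg M) (rinner M x x))"

definition complete_wrt :: "('y \<Rightarrow> real) \<Rightarrow> 'y::ab_group_add set \<Rightarrow> bool" where
  "complete_wrt nrm S \<longleftrightarrow>
     (\<forall>s. (\<forall>n. s n \<in> S) \<and> (\<forall>e>0. \<exists>N::nat. \<forall>m\<ge>N. \<forall>n\<ge>N. nrm (s m - s n) < e)
        \<longrightarrow> (\<exists>l\<in>S. (\<lambda>n. nrm (s n - l)) \<longlonglongrightarrow> 0))"

definition dense_wrt :: "('y \<Rightarrow> real) \<Rightarrow> 'y::ab_group_add set \<Rightarrow> 'y set \<Rightarrow> bool" where
  "dense_wrt nrm S T \<longleftrightarrow> S \<subseteq> T \<and> (\<forall>y\<in>T. \<forall>e>0. \<exists>s\<in>S. nrm (y - s) < e)"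

definition closed_wrt :: "('y \<Rightarrow> real) \<Rightarrow> 'y::ab_group_add set \<Rightarrow> 'y set \<Rightarrow> bool" where
  "closed_wrt nrm T S \<longleftrightarrow> S \<subseteq> T \<and> (\<forall>y\<in>T. (\<forall>e>0. \<exists>s\<in>S. nrm (y - s) < e) \<longrightarrow> y \<in> S)"

definition full_left_hilbert_module ::
    "('l::complex_vector, 'r, 'y::complex_vector) bimodule \<Rightarrow> bool" where
  "full_left_hilbert_module M \<longleftrightarrow>
     csubspace (bcar M) \<and>
     (\<forall>a\<in>acar (lalg M). \<forall>x\<in>bcar M. lact M a x \<in> bcar M) \<and>
     (\<forall>a\<in>acar (lalg M). clinear_on (bcar M) (lact M a)) \<and>
     (\<forall>x\<in>bcar M. clinear_on (acar (lalg M)) (\<lambda>a. lact M a x)) \<and>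
     (\<forall>a\<in>acar (lalg M). \<forall>b\<in>acar (lalg M). \<forall>x\<in>bcar M.
        lact M (amult (lalg M) a b) x = lact M a (lact M b x)) \<and>
     (\<forall>x\<in>bcar M. lact M (aone (lalg M)) x = x) \<and>
     (\<forall>x\<in>bcar M. \<forall>y\<in>bcar M. linner M x y \<in> acar (lalg M)) \<and>
     (\<forall>y\<in>bcar M. clinear_on (bcar M) (\<lambda>x. linner M x y)) \<and>
     (\<forall>a\<in>acar (lalg M). \<forall>x\<in>bcar M. \<forall>y\<in>bcar M.
        linner M (lact M a x) y = amult (lalg M) a (linner M x y)) \<and>
     (\<forall>x\<in>bcar M. \<forall>y\<in>bcar M. astar (lalg M) (linner M x y) = linner M y x) \<and>
     (\<forall>x\<in>bcar M. positive_in (lalg M) (linner M x x)) \<and>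
     (\<forall>x\<in>bcar M. linner M x x = 0 \<longrightarrow> x = 0) \<and>
     complete_wrt (lnorm M) (bcar M) \<and>
     dense_wrt (anorm (lalg M)) (cspan {linner M x y | x y. x \<in> bcar M \<and> y \<in> bcar M})
       (acar (lalg M))"

definition full_right_hilbert_module ::
    "('l, 'r::complex_vector, 'y::complex_vector) bimodule \<Rightarrow> bool" where
  "full_right_hilbert_module M \<longleftrightarrow>
     csubspace (bcar M) \<and>
     (\<forall>b\<in>acar (ralg M). \<forall>x\<in>bcar M. ract M x b \<in> bcar M) \<and>
     (\<forall>b\<in>acar (ralg M). clinear_on (bcar M) (\<lambda>x. ract M x b)) \<and>
     (\<forall>x\<in>bcar M. clinear_on (acar (ralg M)) (ract M x)) \<and>
     (\<forall>a\<in>acar (ralg M). \<forall>b\<in>acar (ralg M). \<forall>x\<in>bcar M.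
        ract M x (amult (ralg M) a b) = ract M (ract M x a) b) \<and>
     (\<forall>x\<in>bcar M. ract M x (aone (ralg M)) = x) \<and>
     (\<forall>x\<in>bcar M. \<forall>y\<in>bcar M. rinner M x y \<in> acar (ralg M)) \<and>
     (\<forall>x\<in>bcar M. clinear_on (bcar M) (rinner M x)) \<and>
     (\<forall>b\<in>acar (ralg M). \<forall>x\<in>bcar M. \<forall>y\<in>bcar M.
        rinner M x (ract M y b) = amult (ralg M) (rinner M x y) b) \<and>
     (\<forall>x\<in>bcar M. \<forall>y\<in>bcar M. astar (ralg M) (rinner M x y) = rinner M y x) \<and>
     (\<forall>x\<in>bcar M. positive_in (ralg M) (rinner M x x)) \<and>
     (\<forall>x\<in>bcar M. rinner M x x = 0 \<longrightarrow> x = 0) \<and>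
     complete_wrt (rnorm M) (bcar M) \<and>
     dense_wrt (anorm (ralg M)) (cspan {rinner M x y | x y. x \<in> bcar M \<and> y \<in> bcar M})
       (acar (ralg M))"

definition equivalence_bimodule ::
    "('l::complex_vector, 'r::complex_vector, 'y::complex_vector) bimodule \<Rightarrow> bool" where
  "equivalence_bimodule M \<longleftrightarrow>
     full_left_hilbert_module M \<and> full_right_hilbert_module M \<and>
     (\<forall>a\<in>acar (lalg M). \<forall>b\<in>acar (ralg M). \<forall>x\<in>bcar M.
        ract M (lact M a x) b = lact M a (ract M x b)) \<and>
     (\<forall>a\<in>acar (lalg M). \<forall>x\<in>bcar M. \<forall>y\<in>bcar M.
        rinner M (lact M a x) y = rinner M x (lact M (astar (lalg M) a) y)) \<and>
     (\<forall>b\<in>acar (ralg M). \<forall>x\<in>bcar M. \<forall>y\<in>bcar M.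
        linner M (ract M x b) y = linner M x (ract M y (astar (ralg M) b))) \<and>
     (\<forall>x\<in>bcar M. \<forall>y\<in>bcar M. \<forall>z\<in>bcar M.
        lact M (linner M x y) z = ract M x (rinner M y z))"

text \<open>The conjugate vector space, underlying the dual bimodule.\<close>

datatype 'a conj = tilde (untilde: 'a)

instantiation conj :: (complex_vector) complex_vector
begin
definition "0 = tilde 0"
definition "x + y = tilde (untilde x + untilde y)"
definition "x - y = tilde (untilde x - untilde y)"
definition "- x = tilde (- untilde x)"
definition "r *\<^sub>C x = tilde (cnj r *\<^sub>C untilde x)"
instance
  by standard
    (simp_all add: zero_conj_def plus_conj_def minus_conj_def uminus_conj_def scaleC_conj_def
      scaleC_add_right scaleC_add_left scaleC_scaleC scaleC_one ac_simps)
end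

definition dual_bimodule :: "('l, 'r, 'y) bimodule \<Rightarrow> ('r, 'l, 'y conj) bimodule" where
  "dual_bimodule M =
     \<lparr>lalg = ralg M, ralg = lalg M, bcar = tilde ` bcar M,
      lact = (\<lambda>b x. tilde (ract M (untilde x) (astar (ralg M) b))),
      ract = (\<lambda>x a. tilde (lact M (astar (lalg M) a) (untilde x))),
      linner = (\<lambda>x y. rinner M (untilde x) (untilde y)),
      rinner = (\<lambda>x y. linner M (untilde x) (untilde y))\<rparr>"

text \<open>\<open>T\<close>, with elementary tensors \<open>t m n\<close>, is the (interior) tensor product \<open>M \<otimes> N\<close> over the
  right algebra of \<open>M\<close>: the Hausdorff completion of the algebraic tensor product for the usual
  inner products. These conditions determine \<open>(T, t)\<close> up to a unique isomorphism of
  bimodules that preserves the inner products and the elementary tensors.\<close>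

definition is_tensor_product ::
    "('l::complex_vector, 'm::complex_vector, 'x::complex_vector) bimodule \<Rightarrow>
     ('m, 'r::complex_vector, 'y::complex_vector) bimodule \<Rightarrow>
     ('l, 'r, 'z::complex_vector) bimodule \<Rightarrow> ('x \<Rightarrow> 'y \<Rightarrow> 'z) \<Rightarrow> bool" where
  "is_tensor_product M N T t \<longleftrightarrow>
     ralg M = lalg N \<and> lalg T = lalg M \<and> ralg T = ralg N \<and>
     equivalence_bimodule T \<and>
     (\<forall>m\<in>bcar M. \<forall>n\<in>bcar N. t m n \<in> bcar T) \<and>
     (\<forall>n\<in>bcar N. clinear_on (bcar M) (\<lambda>m. t m n)) \<and>
     (\<forall>m\<in>bcar M. clinear_on (bcar N) (t m)) \<and>
     (\<forall>m\<in>bcar M. \<forall>n\<in>bcar N. \<forall>b\<in>acar (ralg M). t (ract M m b) n = t m (lact N b n)) \<and>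
     (\<forall>m\<in>bcar M. \<forall>n\<in>bcar N. \<forall>a\<in>acar (lalg M). lact T a (t m n) = t (lact M a m) n) \<and>
     (\<forall>m\<in>bcar M. \<forall>n\<in>bcar N. \<forall>d\<in>acar (ralg N). ract T (t m n) d = t m (ract N n d)) \<and>
     (\<forall>m\<in>bcar M. \<forall>n\<in>bcar N. \<forall>m'\<in>bcar M. \<forall>n'\<in>bcar N.
        linner T (t m n) (t m' n') = linner M (ract M m (linner N n n')) m') \<and>
     (\<forall>m\<in>bcar M. \<forall>n\<in>bcar N. \<forall>m'\<in>bcar M. \<forall>n'\<in>bcar N.
        rinner T (t m n) (t m' n') = rinner N n (lact N (rinner M m m') n')) \<and>
     dense_wrt (rnorm T) (cspan {t m n | m n. m \<in> bcar M \<and> n \<in> bcar N}) (bcar T)"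

section \<open>Strong Morita equivalence of inclusions and conditional expectations\<close>

definition strongly_morita_equivalent ::
    "'c::cstar_algebra set \<Rightarrow> 'd::cstar_algebra set \<Rightarrow>
     ('c, 'd, 'y::complex_vector) bimodule \<Rightarrow> 'y set \<Rightarrow> bool" where
  "strongly_morita_equivalent A B Y X \<longleftrightarrow>
     lalg Y = sub_alg UNIV \<and> ralg Y = sub_alg UNIV \<and> equivalence_bimodule Y \<and>
     csubspace X \<and> closed_wrt (rnorm Y) (bcar Y) X \<and>
     (\<forall>a\<in>A. \<forall>x\<in>X. lact Y a x \<in> X) \<and>
     (\<forall>x\<in>X. \<forall>y\<in>X. linner Y x y \<in> A) \<and>
     closure (cspan {linner Y x y | x y. x \<in> X \<and> y \<in> X}) = A \<and>
     closure (cspan {linner Y y x | y x. y \<in> bcar Y \<and> x \<in> X}) = UNIV \<and>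
     (\<forall>b\<in>B. \<forall>x\<in>X. ract Y x b \<in> X) \<and>
     (\<forall>x\<in>X. \<forall>y\<in>X. rinner Y x y \<in> B) \<and>
     closure (cspan {rinner Y x y | x y. x \<in> X \<and> y \<in> X}) = B \<and>
     closure (cspan {rinner Y y x | y x. y \<in> bcar Y \<and> x \<in> X}) = UNIV"

definition sub_bimodule ::
    "('c::cstar_algebra, 'd::cstar_algebra, 'y) bimodule \<Rightarrow> 'c set \<Rightarrow> 'd set \<Rightarrow> 'y set \<Rightarrow>
     ('c, 'd, 'y) bimodule" where
  "sub_bimodule Y A B X = Y\<lparr>lalg := sub_alg A, ralg := sub_alg B, bcar := X\<rparr>"

definition conditional_expectation :: "'c::cstar_algebra set \<Rightarrow> ('c \<Rightarrow> 'c) \<Rightarrow> bool" where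
  "conditional_expectation A E \<longleftrightarrow>
     clinear_on UNIV E \<and> (\<forall>c. E c \<in> A) \<and> (\<forall>a\<in>A. E a = a) \<and>
     (\<forall>a\<in>A. \<forall>c. E (a * c) = a * E c) \<and> (\<forall>a\<in>A. \<forall>c. E (c * a) = E c * a) \<and>
     (\<forall>c. positive_in (sub_alg A) (E (star c * c)))"

text \<open>Conditional expectations \<open>E\<^sub>X\<close> from a bimodule \<open>Y\<close> onto its subspace \<open>X\<close>; here \<open>A\<close> and \<open>B\<close>
  are subalgebras of the left and the right algebra of \<open>Y\<close>.\<close>

definition bimodule_conditional_expectation ::
    "'l set \<Rightarrow> 'r set \<Rightarrow> ('l \<Rightarrow> 'l) \<Rightarrow> ('r \<Rightarrow> 'r) \<Rightarrow>
     ('l, 'r, 'y::complex_vector) bimodule \<Rightarrow> 'y set \<Rightarrow> ('y \<Rightarrow> 'y) \<Rightarrow> bool" where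
  "bimodule_conditional_expectation A B E\<^sub>A E\<^sub>B Y X E\<^sub>X \<longleftrightarrow>
     clinear_on (bcar Y) E\<^sub>X \<and> E\<^sub>X ` bcar Y = X \<and>
     (\<forall>c\<in>acar (lalg Y). \<forall>x\<in>X. E\<^sub>X (lact Y c x) = lact Y (E\<^sub>A c) x) \<and>
     (\<forall>a\<in>A. \<forall>y\<in>bcar Y. E\<^sub>X (lact Y a y) = lact Y a (E\<^sub>X y)) \<and>
     (\<forall>y\<in>bcar Y. \<forall>x\<in>X. E\<^sub>A (linner Y y x) = linner Y (E\<^sub>X y) x) \<and>
     (\<forall>d\<in>acar (ralg Y). \<forall>x\<in>X. E\<^sub>X (ract Y x d) = ract Y x (E\<^sub>B d)) \<and>
     (\<forall>b\<in>B. \<forall>y\<in>bcar Y. E\<^sub>X (ract Y y b) = ract Y (E\<^sub>X y) b) \<and>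
     (\<forall>y\<in>bcar Y. \<forall>x\<in>X. E\<^sub>B (rinner Y y x) = rinner Y (E\<^sub>X y) x)"

section \<open>Watatani index and the basic construction\<close>

text \<open>A quasi-basis \<open>{(u\<^sub>i, u\<^sub>i\<^sup>*)}\<close> is given by the list of the \<open>u\<^sub>i\<close>.\<close>

definition quasi_basis :: "('c::cstar_algebra \<Rightarrow> 'c) \<Rightarrow> 'c list \<Rightarrow> bool" where
  "quasi_basis E us \<longleftrightarrow>
     (\<forall>c. (\<Sum>u\<leftarrow>us. u * E (star u * c)) = c \<and> (\<Sum>u\<leftarrow>us. E (c * u) * star u) = c)"

definition watatani_index :: "('c::cstar_algebra \<Rightarrow> 'c) \<Rightarrow> 'c" where
  "watatani_index E = (THE w. \<exists>us. quasi_basis E us \<and> w = (\<Sum>u\<leftarrow>us. u * star u))"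

definition alg_inverse :: "'c::cstar_algebra \<Rightarrow> 'c" where
  "alg_inverse w = (THE v. v * w = 1 \<and> w * v = 1)"

text \<open>The basic construction is realised as an algebra of operators on the right Hilbert
  \<open>A\<close>-module \<open>C\<close> with inner product \<open>E (star x * y)\<close>. Elements of \<open>C\<close> act by left
  multiplication (\<open>lmult\<close>), and the Jones projection is \<open>E\<close> itself.\<close>

definition lmult :: "'c::cstar_algebra \<Rightarrow> 'c \<Rightarrow> 'c" where
  "lmult c = (\<lambda>z. c * z)"

definition jones :: "('c::cstar_algebra \<Rightarrow> 'c) \<Rightarrow> 'c \<Rightarrow> 'c \<Rightarrow> 'c \<Rightarrow> 'c" where
  "jones E c1 c2 = lmult c1 \<circ> E \<circ> lmult c2"

definition adjoint_op :: "('c::cstar_algebra \<Rightarrow> 'c) \<Rightarrow> ('c \<Rightarrow> 'c) \<Rightarrow> 'c \<Rightarrow> 'c" where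
  "adjoint_op E T = (THE S. \<forall>x y. E (star (T x) * y) = E (star x * S y))"

definition op_norm :: "('c::cstar_algebra \<Rightarrow> 'c) \<Rightarrow> ('c \<Rightarrow> 'c) \<Rightarrow> real" where
  "op_norm E T =
     (SUP x\<in>{x. norm (E (star x * x)) \<le> 1}. sqrt (norm (E (star (T x) * T x))))"

definition basic_construction :: "('c::cstar_algebra \<Rightarrow> 'c) \<Rightarrow> ('c \<Rightarrow> 'c) star_alg" where
  "basic_construction E =
     \<lparr>acar = cspan {jones E c1 c2 | c1 c2. True}, amult = (\<circ>), aone = id,
      astar = adjoint_op E, anorm = op_norm E\<rparr>"

text \<open>The map below is only determined on the basic construction, where it is unique.\<close>

definition dual_expectation :: "('c::cstar_algebra \<Rightarrow> 'c) \<Rightarrow> ('c \<Rightarrow> 'c) \<Rightarrow> 'c" where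
  "dual_expectation E = (SOME F. clinear_on (acar (basic_construction E)) F \<and>
     (\<forall>c1 c2. F (jones E c1 c2) = alg_inverse (watatani_index E) * c1 * c2))"

definition basic_bimodule ::
    "'c::cstar_algebra set \<Rightarrow> ('c \<Rightarrow> 'c) \<Rightarrow> ('c \<Rightarrow> 'c, 'c, 'c) bimodule" where
  "basic_bimodule A E =
     \<lparr>lalg = basic_construction E, ralg = sub_alg A, bcar = UNIV,
      lact = (\<lambda>T z. T z), ract = (*),
      linner = (\<lambda>x y. jones E x (star y)), rinner = (\<lambda>x y. E (star x * y))\<rparr>"

section \<open>The embedding of \<open>Y\<close> and the dual expectation on \<open>Y\<^sub>1\<close>\<close>

text \<open>In both definitions \<open>t c x d\<close> stands for the elementary tensor of \<open>c\<close>, \<open>x\<close> and \<open>tilde d\<close>.\<close>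

definition upward_embedding ::
    "('c::cstar_algebra, 'd::cstar_algebra, 'y) bimodule \<Rightarrow> ('y \<Rightarrow> 'y) \<Rightarrow>
     ('c \<Rightarrow> 'y \<Rightarrow> 'd \<Rightarrow> 'z::complex_vector) \<Rightarrow> 'c list \<Rightarrow> 'd list \<Rightarrow> 'y \<Rightarrow> 'z" where
  "upward_embedding Y E\<^sub>X t us vs y =
     (\<Sum>u\<leftarrow>us. \<Sum>v\<leftarrow>vs. t u (E\<^sub>X (ract Y (lact Y (star u) y) v)) v)"

definition dual_bimodule_expectation ::
    "('c::cstar_algebra \<Rightarrow> 'c) \<Rightarrow> ('c, 'd::cstar_algebra, 'y::complex_vector) bimodule \<Rightarrow> 'y set \<Rightarrow>
     ('e, 'f, 'z::complex_vector) bimodule \<Rightarrow> ('c \<Rightarrow> 'y \<Rightarrow> 'd \<Rightarrow> 'z) \<Rightarrow> 'z \<Rightarrow> 'y" where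
  "dual_bimodule_expectation E\<^sub>A Y X Y1 t = (SOME F.
     clinear_on (bcar Y1) F \<and> F ` bcar Y1 \<subseteq> bcar Y \<and>
     (\<forall>c d. \<forall>x\<in>X. F (t c x d) =
        lact Y (alg_inverse (watatani_index E\<^sub>A)) (ract Y (lact Y c x) (star d))))"

end

theory Submission
  imports Defs
begin

text \<open>
  Write \<open>z = c \<otimes> x \<otimes> d~\<close> for an elementary tensor of \<open>Y\<^sub>1\<close>, and \<open>w\<^sub>A\<close>, \<open>w\<^sub>B\<close> for the two
  Watatani indices. The argument pairs everything with such \<open>z\<close>. Although \<open>\<phi>(y)\<close> is a double sum over
  both quasi-bases, the quasi-basis identities collapse its inner products with \<open>z\<close> to a single
  generator of each basic construction (lemmas \<open>embed_linner_elem\<close>, \<open>elem_rinner_embed\<close>):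
  the left product of \<open>\<phi>(y)\<close> and \<open>z\<close> is \<open>\<langle>y\<cdot>d, x\<rangle> e\<^sub>A c\<^sup>*\<close>, and the right product of
  \<open>z\<close> and \<open>\<phi>(y)\<close> is \<open>d e\<^sub>B \<langle>x, c\<^sup>*\<cdot>y\<rangle>\<close>. The dual expectations turn these into
  inner products of \<open>y\<close> with \<open>w\<^sub>A\<^sup>-\<^sup>1\<cdot>c\<cdot>x\<cdot>d\<^sup>*\<close>. So \<open>E\<^sup>Y\<close> is the adjoint of \<open>\<phi>\<close> for the
  inner products followed by \<open>E\<^sup>C\<close>, respectively \<open>E\<^sup>D\<close>. This relation gives the two axioms about inner
  products and also the existence of \<open>E\<^sup>Y\<close>, which can be written as
  \<open>\<Sum>\<^sub>k E\<^sup>C(\<langle>\<xi>, \<phi>(y\<^sub>k)\<rangle>)\<cdot>x\<^sub>k\<close> whenever \<open>\<Sum>\<^sub>k \<langle>y\<^sub>k, x\<^sub>k\<rangle>\<^sub>D = 1\<close>.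

  Three further facts are used. First, \<open>Y\<^sub>1\<close> is algebraically spanned by the elementary tensors,
  because the unit of \<open>D\<^sub>1\<close> is a finite sum of their inner products (\<open>reconstruction\<close>). Linear maps on
  \<open>Y\<^sub>1\<close> are therefore determined by their values on elementary tensors without any continuity, and an
  element of \<open>Y\<^sub>1\<close> is determined by its inner products with them. Second, the formula for
  \<open>E\<^sup>Y\<close> mentions only \<open>w\<^sub>A\<close>; it is symmetric in the two sides because \<open>w\<^sub>A\<cdot>y = y\<cdot>w\<^sub>B\<close>: both equal
  \<open>\<Sum>\<^sub>i\<^sub>j u\<^sub>i\<cdot>E\<^sup>X(u\<^sub>i\<^sup>*\<cdot>y\<cdot>v\<^sub>j)\<cdot>v\<^sub>j\<^sup>*\<close> (\<open>index_intertwined\<close>). The same kind of double sum gives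
  \<open>E\<^sup>Y(T\<cdot>\<phi>(y)) = E\<^sup>C(T)\<cdot>y\<close> and its mirror image, and in particular \<open>E\<^sup>Y(\<phi>(y)) = y\<close>.

  Third, the index is invertible. This is the main analytic point. From
  \<open>1 = \<Sum>\<^sub>i E\<^sup>A(u\<^sub>i)u\<^sub>i\<^sup>*\<close> the norm of \<open>a\<close> is controlled by the norms of the \<open>u\<^sub>i\<^sup>*a\<close>, and these are
  controlled by \<open>a\<^sup>*w\<^sub>Aa = \<Sum>\<^sub>i (u\<^sub>i\<^sup>*a)\<^sup>*(u\<^sub>i\<^sup>*a)\<close> once the norm is known to be monotone on sums of
  elements \<open>x\<^sup>*x\<close>. That rests on the positivity of \<open>x\<^sup>*x\<close> (\<open>cpos_star_mult\<close>), which is proved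
  from a norm criterion for positivity and square roots obtained by a contraction.
\<close>

section \<open>Involution and invertible elements\<close>


lemma star_zero [simp]: "star (0 :: 'c::cstar_algebra) = 0"
  using star_add[of "0::'c" 0] by simp

lemma star_minus: "star (- x) = - star (x :: 'c::cstar_algebra)"
  using star_add[of x "- x"] by (simp add: add_eq_0_iff)

lemma star_diff: "star (x - y) = star x - star (y :: 'c::cstar_algebra)"
  using star_add[of x "- y"] by (simp add: star_minus)

lemma star_one [simp]: "star (1 :: 'c::cstar_algebra) = 1"
  by (metis mult.left_neutral mult.right_neutral star_mult star_star)

lemma star_scaleR: "star (r *\<^sub>R x) = r *\<^sub>R star (x :: 'c::cstar_algebra)"
  by (simp add: scaleR_scaleC star_scaleC)

lemma star_of_real [simp]: "star (of_real r :: 'c::cstar_algebra) = of_real r"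
  by (simp add: of_real_def star_scaleR)

lemma norm_star [simp]: "norm (star x) = norm (x :: 'c::cstar_algebra)"
proof -
  have le: "norm z \<le> norm (star z)" for z :: 'c
  proof (cases "norm z = 0")
    case False
    have "norm z * norm z \<le> norm (star z) * norm z"
      using norm_mult_ineq[of "star z" z] by (simp add: norm_star_mult power2_eq_square)
    then show ?thesis using False by simp
  qed simp
  show ?thesis using le[of x] le[of "star x"] by (simp add: star_star)
qed

lemma bounded_linear_star: "bounded_linear (star :: 'c::cstar_algebra \<Rightarrow> 'c)"
  by (rule bounded_linear_intro[of _ 1]) (simp_all add: star_add star_scaleR)

lemmas tendsto_star = bounded_linear.tendsto[OF bounded_linear_star]

definition inverse_pair :: "'c::cstar_algebra \<Rightarrow> 'c \<Rightarrow> bool" where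
  "inverse_pair x v \<longleftrightarrow> v * x = 1 \<and> x * v = 1"

abbreviation invertible_elem :: "'c::cstar_algebra \<Rightarrow> bool" where
  "invertible_elem x \<equiv> \<exists>v. inverse_pair x v"

lemma inverse_pair_unique: "inverse_pair x v \<Longrightarrow> inverse_pair x v' \<Longrightarrow> v = v'"
  unfolding inverse_pair_def by (metis mult.assoc mult.left_neutral mult.right_neutral)

lemma inverse_pair_commute:
  assumes "inverse_pair x v" "x * z = z * x"
  shows "v * z = z * v"
proof -
  have "v * z = v * (z * x) * v" using assms(1) by (simp add: inverse_pair_def mult.assoc)
  also have "\<dots> = v * (x * z) * v" using assms(2) by simp
  also have "\<dots> = z * v" using assms(1) by (simp add: inverse_pair_def flip: mult.assoc)
  finally show ?thesis .
qed

lemma inverse_pair_star: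
  assumes "inverse_pair x v" "star x = x"
  shows "star v = v"
  using assms
  by (metis inverse_pair_def inverse_pair_unique star_mult star_one)

lemma invertible_elem_commuting_factor:
  assumes "invertible_elem (x * y)" "x * y = y * x"
  shows "invertible_elem x"
proof -
  obtain v where v: "inverse_pair (x * y) v" using assms(1) by blast
  have "v * x = x * v" by (rule inverse_pair_commute[OF v]) (metis assms(2) mult.assoc)
  then have "v * y * x = 1" "x * (v * y) = 1"
    using v assms(2) unfolding inverse_pair_def by (metis mult.assoc)+
  then have "inverse_pair x (v * y)" by (simp add: inverse_pair_def)
  then show ?thesis ..
qed

lemma invertible_elem_near_one:
  assumes "norm (1 - x) < 1"
  shows "invertible_elem x"
proof -
  let ?S = "\<Sum>n. (1 - x) ^ n"
  have sm: "summable (\<lambda>n. (1 - x) ^ n)"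
    by (rule complete_algebra_summable_geometric[OF assms])
  have split: "?S = 1 + (\<Sum>n. (1 - x) ^ Suc n)"
    using suminf_split_head[OF sm] by simp
  have l: "(\<Sum>n. (1 - x) ^ Suc n) = (1 - x) * ?S"
    using suminf_mult[OF sm, of "1 - x"] by simp
  have r: "(\<Sum>n. (1 - x) ^ Suc n) = ?S * (1 - x)"
    using suminf_mult2[OF sm, of "1 - x"] by (simp add: power_commutes)
  have "x * ?S = 1" using split unfolding l by (simp add: algebra_simps)
  moreover have "?S * x = 1" using split unfolding r by (simp add: algebra_simps)
  ultimately show ?thesis by (auto simp: inverse_pair_def)
qed

lemma invertible_elem_scaleR:
  assumes "invertible_elem x" "r \<noteq> 0"
  shows "invertible_elem (r *\<^sub>R x)"
proof -
  obtain v where "inverse_pair x v" using assms by blast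
  then have "inverse_pair (r *\<^sub>R x) ((1 / r) *\<^sub>R v)" using assms by (simp add: inverse_pair_def)
  then show ?thesis ..
qed

lemma invertible_elem_near_of_real:
  assumes "norm (of_real t - x) < t"
  shows "invertible_elem x"
proof -
  have t: "t > 0" using assms norm_ge_zero[of "of_real t - x"] by linarith
  have "1 - (1 / t) *\<^sub>R x = (1 / t) *\<^sub>R (of_real t - x)"
    using t by (simp add: scaleR_diff_right of_real_def)
  then have "norm (1 - (1 / t) *\<^sub>R x) < 1" using assms t by simp
  then have "invertible_elem ((1 / t) *\<^sub>R x)" by (rule invertible_elem_near_one)
  from invertible_elem_scaleR[OF this, of t] show ?thesis using t by simp
qed

text \<open>If \<open>v\<close> inverts \<open>r - ab\<close>, then \<open>(1 + bva)/r\<close> inverts \<open>r - ba\<close>: away from \<open>0\<close>, the products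
\<open>ab\<close> and \<open>ba\<close> have the same spectrum.\<close>

lemma invertible_elem_swap:
  assumes "invertible_elem (of_real r - a * b)" "r \<noteq> 0"
  shows "invertible_elem (of_real r - b * a)"
proof -
  obtain v where "inverse_pair (of_real r - a * b) v" using assms by blast
  then have v: "a * b * v = r *\<^sub>R v - 1" "v * a * b = r *\<^sub>R v - 1"
    by (auto simp: inverse_pair_def of_real_def algebra_simps)
  have bab: "b * a * b * v = r *\<^sub>R (b * v) - b" 
    using arg_cong[OF v(1), of "(*) b"] by (simp add: algebra_simps)
  have vab: "v * a * b * a = r *\<^sub>R (v * a) - a"
    using arg_cong[OF v(2), of "\<lambda>z. z * a"] by (simp add: algebra_simps)
  define p where "p = b * v * a"
  define q where "q = b * a"
  have "q * p = r *\<^sub>R p - q" "p * q = r *\<^sub>R p - q"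
    using arg_cong[OF bab, of "\<lambda>z. z * a"] arg_cong[OF vab, of "\<lambda>z. b * z"]
    by (simp_all add: p_def q_def algebra_simps)
  then have "(1 + p) * (r *\<^sub>R 1 - q) = r *\<^sub>R 1" "(r *\<^sub>R 1 - q) * (1 + p) = r *\<^sub>R 1"
    by (simp_all add: algebra_simps)
  then have "inverse_pair (of_real r - q) ((1 / r) *\<^sub>R (1 + p))"
    using assms(2) by (simp add: inverse_pair_def of_real_def)
  then show ?thesis unfolding q_def ..
qed

section \<open>Square roots and positive elements\<close>

text \<open>The root is \<open>1 - r\<close> for a fixed point \<open>r\<close> of \<open>r \<mapsto> (k + r\<^sup>2)/2\<close>, which contracts the ball of radius
\<open>norm k\<close>. The map also preserves the closed set of self-adjoint elements that commute with everything
commuting with \<open>k\<close>, so the fixed point can be found there.\<close>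

lemma sqrt_exists_unit:
  fixes k :: "'c::cstar_algebra"
  assumes sa: "star k = k" and small: "norm k < 1"
  shows "\<exists>s. star s = s \<and> s * s = 1 - k \<and> (\<forall>z. z * k = k * z \<longrightarrow> z * s = s * z)"
proof -
  define S where "S = {r. norm r \<le> norm k \<and> star r = r \<and> (\<forall>z. z * k = k * z \<longrightarrow> z * r = r * z)}"
  have SD: "norm r \<le> norm k" "star r = r" "z * k = k * z \<Longrightarrow> z * r = r * z" if "r \<in> S" for r z
    using that unfolding S_def by blast+
  have SI: "r \<in> S" if "norm r \<le> norm k" "star r = r" "\<And>z. z * k = k * z \<Longrightarrow> z * r = r * z" for r
    using that unfolding S_def by blast
  define f where "f r = (1/2) *\<^sub>R (k + r * r)" for r
  have "complete S"
  proof (unfold complete_eq_closed closed_sequential_limits, intro allI impI, elim conjE)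
    fix x l assume x: "\<forall>n. x n \<in> S" and l: "x \<longlonglongrightarrow> l"
    have "norm l \<le> norm k"
      by (rule LIMSEQ_le_const2[OF tendsto_norm[OF l]]) (use x SD(1) in blast)
    moreover have "star l = l"
      using LIMSEQ_unique[OF tendsto_star[OF l], of l] l x SD(2) by simp
    moreover have "z * l = l * z" if z: "z * k = k * z" for z
    proof -
      have "(\<lambda>n. z * x n) \<longlonglongrightarrow> z * l" "(\<lambda>n. x n * z) \<longlonglongrightarrow> l * z" by (intro tendsto_intros l)+
      moreover have "(\<lambda>n. z * x n) = (\<lambda>n. x n * z)" using x SD(3)[OF _ z] by blast
      ultimately show ?thesis using LIMSEQ_unique by metis
    qed
    ultimately show "l \<in> S" by (rule SI)
  qed
  moreover have "0 \<in> S" by (rule SI) simp_all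
  then have "S \<noteq> {}" by blast
  moreover have "f ` S \<subseteq> S"
  proof
    fix y assume "y \<in> f ` S"
    then obtain r where r: "r \<in> S" "y = f r" by blast
    have "norm (r * r) \<le> norm k * norm k"
      by (rule order_trans[OF norm_mult_ineq]) (use SD(1)[OF r(1)] in \<open>auto intro: mult_mono\<close>)
    also have "\<dots> \<le> norm k" using small by (simp add: mult_left_le)
    finally have "norm (k + r * r) \<le> 2 * norm k" using norm_triangle_ineq[of k "r * r"] by linarith
    then have "norm y \<le> norm k" by (simp add: r f_def)
    moreover have "star y = y" using SD(2)[OF r(1)] sa by (simp add: r(2) f_def star_scaleR star_add star_mult)
    moreover have "z * y = y * z" if z: "z * k = k * z" for z
    proof -
      have "z * r = r * z" by (rule SD(3)[OF r(1) z])
      then have "z * (r * r) = r * r * z" by (metis mult.assoc)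
      then show ?thesis using z by (simp add: r(2) f_def distrib_left distrib_right)
    qed
    ultimately show "y \<in> S" by (rule SI)
  qed
  moreover have "dist (f r) (f r') \<le> norm k * dist r r'" if "r \<in> S" "r' \<in> S" for r r'
  proof -
    have "f r - f r' = (1/2) *\<^sub>R (r * (r - r') + (r - r') * r')"
      by (simp add: f_def algebra_simps)
    moreover have "norm (r * (r - r') + (r - r') * r') \<le> norm r * norm (r - r') + norm (r - r') * norm r'"
      by (intro order_trans[OF norm_triangle_ineq] add_mono norm_mult_ineq)
    moreover have "norm r * norm (r - r') \<le> norm k * norm (r - r')"
      "norm (r - r') * norm r' \<le> norm k * norm (r - r')"
      using SD(1)[OF that(1)] SD(1)[OF that(2)] by (auto simp: mult_right_mono mult.commute)
    ultimately show ?thesis by (simp add: dist_norm)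
  qed
  ultimately obtain r where r: "r \<in> S" "f r = r"
    using Banach_fix[of S "norm k" f] small by auto
  have "r + r = k + r * r" using r(2) unfolding f_def
    by (metis (no_types, lifting) scaleR_2 scaleR_half_double scaleR_left.add scaleR_right_distrib)
  then have "(1 - r) * (1 - r) = 1 - k" by (simp add: algebra_simps)
  moreover have "star (1 - r) = 1 - r" using SD(2)[OF r(1)] by (simp add: star_diff)
  moreover have "\<forall>z. z * k = k * z \<longrightarrow> z * (1 - r) = (1 - r) * z"
    using SD(3)[OF r(1)] by (simp add: left_diff_distrib right_diff_distrib)
  ultimately show ?thesis by blast
qed

lemma sqrt_exists:
  fixes k :: "'c::cstar_algebra"
  assumes sa: "star k = k" and small: "norm k < T"
  shows "\<exists>s. star s = s \<and> s * s = of_real T - k \<and> (\<forall>z. z * k = k * z \<longrightarrow> z * s = s * z)"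
proof -
  have T: "T > 0" using small norm_ge_zero[of k] by linarith
  have "star ((1 / T) *\<^sub>R k) = (1 / T) *\<^sub>R k" "norm ((1 / T) *\<^sub>R k) < 1"
    using T sa small by (simp_all add: star_scaleR)
  from sqrt_exists_unit[OF this] obtain s where s: "star s = s" "s * s = 1 - (1 / T) *\<^sub>R k"
      "\<And>z. z * ((1 / T) *\<^sub>R k) = (1 / T) *\<^sub>R k * z \<Longrightarrow> z * s = s * z"
    by blast
  have comm: "z * s = s * z" if "z * k = k * z" for z
    by (rule s(3)) (simp add: that)
  have "(sqrt T *\<^sub>R s) * (sqrt T *\<^sub>R s) = of_real T - k"
    using T by (simp add: s(2) scaleR_diff_right of_real_def)
  moreover have "star (sqrt T *\<^sub>R s) = sqrt T *\<^sub>R s" by (simp add: star_scaleR s(1))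
  moreover have "\<forall>z. z * k = k * z \<longrightarrow> z * (sqrt T *\<^sub>R s) = (sqrt T *\<^sub>R s) * z"
    unfolding mult_scaleR_left mult_scaleR_right using comm by metis
  ultimately show ?thesis by blast
qed

lemma norm_sa_square: "star d = d \<Longrightarrow> norm (d * d) = (norm (d :: 'c::cstar_algebra))\<^sup>2"
  by (metis norm_star_mult)

text \<open>The element \<open>u = d + \<i>e\<close> satisfies \<open>u\<^sup>*u = r\<close>, and \<open>d\<close> is its real part. This is how norms of
self-adjoint elements are bounded without functional calculus.\<close>

lemma norm_le_of_squares_sum:
  fixes d e :: "'c::cstar_algebra"
  assumes "star d = d" "star e = e" "d * e = e * d" "d * d + e * e = of_real r" "r \<ge> 0"
  shows "norm (d * d) \<le> r"
proof -
  define u where "u = d + \<i> *\<^sub>C e"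
  have su: "star u = d - \<i> *\<^sub>C e"
    using assms by (simp add: u_def star_add star_scaleC complex_vector.scale_minus_left)
  have "star u * u = (d - \<i> *\<^sub>C e) * (d + \<i> *\<^sub>C e)"
    by (simp only: su) (simp only: u_def)
  also have "\<dots> = d * d + e * e"
    using assms(3)
    by (simp add: distrib_left left_diff_distrib scaleC_mult_left scaleC_mult_right scaleC_scaleC scaleC_one
        complex_vector.scale_minus_left complex_vector.scale_right_diff_distrib)
  finally have "(norm u)\<^sup>2 = r" using assms norm_star_mult[of u] by simp
  have "2 *\<^sub>R d = u + star u" by (simp only: su) (simp add: u_def scaleR_2)
  then have "2 * norm d \<le> norm u + norm (star u)" using norm_triangle_ineq[of u "star u"]
    by (metis abs_numeral norm_scaleR)
  then have "norm d \<le> norm u" by simp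
  then have "(norm d)\<^sup>2 \<le> (norm u)\<^sup>2" by (simp add: power_mono)
  then show ?thesis using \<open>(norm u)\<^sup>2 = r\<close> assms by (simp add: norm_sa_square)
qed

text \<open>Positivity, expressed by the norm: the spectrum of \<open>h\<close> lies in the disc of radius \<open>t\<close> around \<open>t\<close>.\<close>

definition cpos :: "'c::cstar_algebra \<Rightarrow> bool" where
  "cpos h \<longleftrightarrow> star h = h \<and> (\<exists>t. norm (of_real t - h) \<le> t)"

lemma cpos_sa: "cpos h \<Longrightarrow> star h = h" by (simp add: cpos_def)

lemma cpos_of_real: "r \<ge> 0 \<Longrightarrow> cpos (of_real r)"
  unfolding cpos_def by (auto intro!: exI[of _ r])

lemma cpos_add: "cpos g \<Longrightarrow> cpos h \<Longrightarrow> cpos (g + h)"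
proof -
  assume "cpos g" "cpos h"
  then obtain s t where st: "norm (of_real s - g) \<le> s" "norm (of_real t - h) \<le> t" "star g = g" "star h = h"
    by (auto simp: cpos_def)
  have eq: "of_real (s + t) - (g + h) = (of_real s - g) + (of_real t - h)" by simp
  have "norm (of_real (s + t) - (g + h)) \<le> s + t"
    unfolding eq by (rule norm_triangle_le) (use st in linarith)
  then show ?thesis using st(3,4) unfolding cpos_def by (metis star_add)
qed

text \<open>Since \<open>t - h\<close> may have norm exactly \<open>t\<close>, the contraction yields a root only after a shift by
\<open>\<epsilon>\<close>. This is enough, because positivity is a closed condition.\<close>

lemma cpos_sqrt:
  assumes "cpos h" "\<epsilon> > 0"
  shows "\<exists>d. star d = d \<and> d * d = h + of_real \<epsilon> \<and> (\<forall>z. z * h = h * z \<longrightarrow> z * d = d * z)"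
proof -
  obtain t where t: "norm (of_real t - h) \<le> t" "star h = h" using assms by (auto simp: cpos_def)
  have less: "norm (of_real t - h) < t + \<epsilon>" using t(1) assms(2) by linarith
  have t_sa: "star (of_real t - h) = of_real t - h" by (simp add: star_diff t(2))
  obtain d where d: "star d = d" "d * d = of_real (t + \<epsilon>) - (of_real t - h)"
      "\<And>z. z * (of_real t - h) = (of_real t - h) * z \<Longrightarrow> z * d = d * z"
    using sqrt_exists[of "of_real t - h" "t + \<epsilon>"] less t_sa by blast
  have "z * d = d * z" if "z * h = h * z" for z
    by (rule d(3)) (simp add: algebra_simps of_real_def that)
  moreover have "d * d = h + of_real \<epsilon>" using d(2) by simp
  ultimately show ?thesis using d(1) by blast
qed

lemma complementary_root_exists:
  assumes "star d = d" "norm (d * d) < T"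
  shows "\<exists>e. star e = e \<and> e * e = of_real T - d * d \<and> d * e = e * d"
proof -
  have "star (d * d) = d * d" by (simp add: star_mult assms(1))
  from sqrt_exists[OF this assms(2)] obtain e where
    e: "star e = e" "e * e = of_real T - d * d" "\<And>z. z * (d * d) = d * d * z \<Longrightarrow> z * e = e * z"
    by blast
  have "d * e = e * d" by (rule e(3)) (simp add: mult.assoc)
  with e(1,2) show ?thesis by blast
qed

lemma cpos_square:
  assumes "star d = d"
  shows "cpos (d * d)"
proof -
  define T where "T = norm (d * d) + 1"
  have T: "norm (d * d) < T" "T \<ge> 0" by (auto simp: T_def)
  obtain e where e: "star e = e" "e * e = of_real T - d * d" "d * e = e * d"
    using complementary_root_exists[OF assms T(1)] by blast
  from e(3) have "norm (e * e) \<le> T"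
    by (intro norm_le_of_squares_sum[OF e(1) assms _ _ T(2)]) (simp_all only: e(2) diff_add_cancel)
  then have "norm (of_real T - d * d) \<le> T" by (simp only: e(2))
  then show ?thesis using assms unfolding cpos_def by (metis star_mult)
qed

text \<open>The defining estimate of \<open>cpos\<close> for one \<open>t\<close> implies it for every \<open>t \<ge> norm h\<close>: if
\<open>h + \<delta> = d\<^sup>2\<close> and \<open>e\<^sup>2 = T - d\<^sup>2\<close>, then \<open>e\<^sup>2\<close> has norm at most \<open>T\<close>. Having a fixed admissible
\<open>t\<close>, namely \<open>norm h\<close>, is what makes positivity stable under limits.\<close>

lemma cpos_norm_bound:
  assumes "cpos h" "t \<ge> norm h"
  shows "norm (of_real t - h) \<le> t"
proof (rule field_le_epsilon)
  fix \<epsilon> :: real assume \<epsilon>: "\<epsilon> > 0"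
  define \<delta> where "\<delta> = \<epsilon> / 3"
  have \<delta>: "\<delta> > 0" using \<epsilon> by (simp add: \<delta>_def)
  obtain d where d: "star d = d" "d * d = h + of_real \<delta>" using cpos_sqrt[OF assms(1) \<delta>] by blast
  \<comment> \<open>the second \<delta> makes the norm of d * d strictly smaller than T\<close>
  define T where "T = t + \<delta> + \<delta>"
  have "norm (d * d) \<le> norm h + \<delta>" unfolding d(2) using norm_triangle_ineq[of h "of_real \<delta>"] \<delta> by simp
  then have T: "norm (d * d) < T" "T \<ge> 0"
    using \<delta> assms norm_ge_zero[of h] unfolding T_def by linarith+
  obtain e where e: "star e = e" "e * e = of_real T - d * d" "d * e = e * d"
    using complementary_root_exists[OF d(1) T(1)] by blast
  from e(3) have *: "norm (e * e) \<le> T"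
    by (intro norm_le_of_squares_sum[OF e(1) d(1) _ _ T(2)]) (simp_all only: e(2) diff_add_cancel)
  have eq: "of_real t - h = e * e - of_real \<delta>" 
    by (simp only: e(2) d(2) T_def of_real_add diff_diff_eq add.assoc add_diff_cancel_right)
  have "norm (of_real t - h) \<le> T + \<delta>"
    unfolding eq using * norm_triangle_ineq4[of "e * e" "of_real \<delta>"] \<delta> by simp
  then show "norm (of_real t - h) \<le> t + \<epsilon>" by (simp add: T_def \<delta>_def)
qed

lemma cpos_limit:
  assumes "\<And>n. cpos (h n)" "h \<longlonglongrightarrow> l"
  shows "cpos l"
proof -
  have "norm (of_real (norm l) - l) \<le> norm l"
  proof (rule LIMSEQ_le)
    show "(\<lambda>n. norm (of_real (norm (h n)) - h n)) \<longlonglongrightarrow> norm (of_real (norm l) - l)"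
      by (intro tendsto_intros assms)
    show "(\<lambda>n. norm (h n)) \<longlonglongrightarrow> norm l" by (intro tendsto_intros assms)
    show "\<exists>N. \<forall>n\<ge>N. norm (of_real (norm (h n)) - h n) \<le> norm (h n)"
      using cpos_norm_bound[OF assms(1)] by auto
  qed
  moreover have "star l = l"
    using LIMSEQ_unique[OF tendsto_star[OF assms(2)], of l] assms(2)
    by (simp only: cpos_sa[OF assms(1)])
  ultimately show ?thesis unfolding cpos_def by blast
qed

lemma cpos_approx:
  assumes "\<And>\<epsilon>. \<epsilon> > 0 \<Longrightarrow> cpos (h + of_real \<epsilon>)"
  shows "cpos h"
proof (rule cpos_limit)
  show "cpos (h + of_real (inverse (real (Suc n))))" for n by (rule assms) simp
  show "(\<lambda>n. h + of_real (inverse (real (Suc n)))) \<longlonglongrightarrow> h"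
    using tendsto_add[OF tendsto_const[of h] tendsto_of_real[OF LIMSEQ_inverse_real_of_nat]]
    by (simp only: of_real_0 add_0_right)
qed

text \<open>After shifting both factors by a small \<open>\<epsilon>\<close>, the roots of the factors commute, and the shifted product is
the square of their product.\<close>

lemma cpos_commuting_mult:
  assumes "cpos g" "cpos h" "g * h = h * g"
  shows "cpos (g * h)"
proof (rule cpos_limit)
  let ?\<epsilon> = "\<lambda>n. of_real (inverse (real (Suc n))) :: 'a"
  show "cpos ((g + ?\<epsilon> n) * (h + ?\<epsilon> n))" for n
  proof -
    have inverse_Suc: "inverse (real (Suc n)) > 0" by simp
    obtain d where d: "star d = d" "d * d = g + ?\<epsilon> n" "\<And>z. z * g = g * z \<Longrightarrow> z * d = d * z"
      using cpos_sqrt[OF assms(1) inverse_Suc] by blast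
    obtain e where e: "star e = e" "e * e = h + ?\<epsilon> n" "\<And>z. z * h = h * z \<Longrightarrow> z * e = e * z"
      using cpos_sqrt[OF assms(2) inverse_Suc] by blast
    have "h * d = d * h" by (rule d(3)) (simp add: assms)
    then have de: "d * e = e * d" by (intro e(3)) simp
    have "(d * d) * (e * e) = (d * e) * (d * e)" using de by (metis mult.assoc)
    moreover have "star (d * e) = d * e" using d(1) e(1) de by (simp add: star_mult)
    ultimately show ?thesis using cpos_square[of "d * e"] d(2) e(2) by simp
  qed
  have "?\<epsilon> \<longlonglongrightarrow> 0" using tendsto_of_real[OF LIMSEQ_inverse_real_of_nat] by (simp only: of_real_0)
  then have "(\<lambda>n. (g + ?\<epsilon> n) * (h + ?\<epsilon> n)) \<longlonglongrightarrow> (g + 0) * (h + 0)" by (intro tendsto_intros)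
  then show "(\<lambda>n. (g + ?\<epsilon> n) * (h + ?\<epsilon> n)) \<longlonglongrightarrow> g * h" by simp
qed

lemma cpos_scaleR:
  assumes "cpos h" "r \<ge> 0"
  shows "cpos (r *\<^sub>R h)"
  using cpos_commuting_mult[OF cpos_of_real[OF assms(2)] assms(1)] by (simp add: of_real_def)

lemma cpos_norm_minus:
  assumes "cpos h" shows "cpos (of_real (norm h) - h)"
  unfolding cpos_def by (intro conjI exI[of _ "norm h"]) (simp_all add: star_diff cpos_sa[OF assms])

lemma invertible_elem_cpos_add:
  assumes "cpos h" "\<epsilon> > 0"
  shows "invertible_elem (h + of_real \<epsilon>)"
proof -
  obtain t where t: "norm (of_real t - h) \<le> t" using assms by (auto simp: cpos_def)
  show ?thesis
    by (rule invertible_elem_near_of_real[of "t + \<epsilon>"]) (use t assms in simp)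
qed

text \<open>The inverse \<open>v = h v\<^sup>2\<close> is positive, so \<open>v \<le> norm v\<close>; multiplying by \<open>h\<close> gives
\<open>1 \<le> norm v \<cdot> h\<close>.\<close>

lemma cpos_invertible_gap:
  assumes "cpos h" "invertible_elem h"
  shows "\<exists>\<delta>>0. cpos (h - of_real \<delta>)"
proof -
  obtain v where v: "inverse_pair h v" using assms by blast
  have vh: "v * h = 1" "h * v = 1" using v by (auto simp: inverse_pair_def)
  have sv: "star v = v" by (rule inverse_pair_star[OF v cpos_sa[OF assms(1)]])
  have "cpos (h * (v * v))"
    by (rule cpos_commuting_mult[OF assms(1) cpos_square[OF sv]]) (simp add: vh mult.assoc flip: mult.assoc[of h])
  then have "cpos v" by (simp add: vh flip: mult.assoc)
  then have "cpos ((of_real (norm v) - v) * h)"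
    by (intro cpos_commuting_mult cpos_norm_minus assms)
      (simp_all add: left_diff_distrib right_diff_distrib vh of_real_def)
  then have *: "cpos (norm v *\<^sub>R h - 1)" by (simp add: algebra_simps vh of_real_def)
  have "norm v > 0" using vh by force
  then have "h - of_real (1 / norm v) = (1 / norm v) *\<^sub>R (norm v *\<^sub>R h - 1)"
    by (simp add: algebra_simps of_real_def)
  then have "cpos (h - of_real (1 / norm v))" using cpos_scaleR[OF *, of "1 / norm v"] by simp
  then show ?thesis using \<open>norm v > 0\<close> by (intro exI[of _ "1 / norm v"]) simp
qed

text \<open>Here \<open>-m\<close> is the bottom of the spectrum of \<open>h\<close>: \<open>m\<close> is the least shift that makes \<open>h\<close> positive, and if
\<open>h + m\<close> were invertible, \<open>cpos_invertible_gap\<close> would allow a smaller one.\<close>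

lemma not_cpos_spectral_bound:
  assumes sa: "star h = h" and np: "\<not> cpos h"
  shows "\<exists>m>0. cpos (h + of_real m) \<and> \<not> invertible_elem (h + of_real m)"
proof -
  define M where "M = {t. 0 \<le> t \<and> cpos (h + of_real t)}"
  define m where "m = Inf M"
  have "cpos (h + of_real (norm h))"
    unfolding cpos_def by (intro conjI exI[of _ "norm h"]) (simp_all add: star_add sa)
  then have "norm h \<in> M" by (simp add: M_def)
  then have ne: "M \<noteq> {}" by blast
  have bdd: "bdd_below M" by (rule bdd_belowI[of _ 0]) (simp add: M_def)
  have m0: "m \<ge> 0" unfolding m_def by (rule cInf_greatest[OF ne]) (simp add: M_def)
  have cp: "cpos (h + of_real m)"
  proof (rule cpos_approx)
    fix \<epsilon> :: real assume "\<epsilon> > 0"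
    then obtain t where t: "t \<in> M" "t < m + \<epsilon>"
      using cInf_lessD[OF ne, of "m + \<epsilon>"] by (auto simp: m_def)
    have "h + of_real m + of_real \<epsilon> = (h + of_real t) + of_real (m + \<epsilon> - t)" by simp
    then show "cpos (h + of_real m + of_real \<epsilon>)"
      using t cpos_add[OF _ cpos_of_real, of "h + of_real t" "m + \<epsilon> - t"] by (simp only: M_def) simp
  qed
  then have "m > 0" using np m0 by (cases "m = 0") auto
  moreover have "\<not> invertible_elem (h + of_real m)"
  proof
    assume "invertible_elem (h + of_real m)"
    then obtain \<delta> where \<delta>: "\<delta> > 0" "cpos (h + of_real m - of_real \<delta>)"
      using cpos_invertible_gap[OF cp] by blast
    define \<delta>' where "\<delta>' = min \<delta> m"
    have "h + of_real (m - \<delta>') = (h + of_real m - of_real \<delta>) + of_real (\<delta> - \<delta>')" by simp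
    then have "cpos (h + of_real (m - \<delta>'))"
      using cpos_add[OF \<delta>(2) cpos_of_real[of "\<delta> - \<delta>'"]] \<delta>'_def
      by (simp add: add_diff_eq)
    then have "m - \<delta>' \<in> M" by (simp add: M_def \<delta>'_def)
    then have "m \<le> m - \<delta>'" unfolding m_def using bdd by (rule cInf_lower)
    then show False using \<delta> \<open>m > 0\<close> by (simp add: \<delta>'_def min_def split: if_splits)
  qed
  ultimately show ?thesis using cp by blast
qed

section \<open>Positivity of star x * x\<close>

lemma cpos_of_invertible:
  assumes "star h = h" "\<And>t. t > 0 \<Longrightarrow> invertible_elem (h + of_real t)"
  shows "cpos h"
  using not_cpos_spectral_bound[OF assms(1)] assms(2) by blast

lemma cpos_star_mult_swap:
  fixes y :: "'c::cstar_algebra"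
  assumes "cpos (of_real s - star y * y)" "s \<ge> 0"
  shows "cpos (of_real s - y * star y)"
proof (rule cpos_of_invertible)
  show "star (of_real s - y * star y) = of_real s - y * star y"
    by (simp add: star_diff star_mult star_star)
  fix t :: real assume t: "t > 0"
  have "invertible_elem (of_real (s + t) - star y * y)"
    using invertible_elem_cpos_add[OF assms(1) t] by (simp add: algebra_simps)
  then have "invertible_elem (of_real (s + t) - y * star y)"
    by (rule invertible_elem_swap) (use assms t in linarith)
  then show "invertible_elem (of_real s - y * star y + of_real t)" by (simp add: algebra_simps)
qed

text \<open>This is twice the sum of the squares of the real and imaginary parts of \<open>y\<close>.\<close>

lemma cpos_symmetric_sum:
  fixes y :: "'c::cstar_algebra"
  shows "cpos (star y * y + y * star y)"
proof -
  define a where "a = y + star y"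
  define b where "b = \<i> *\<^sub>C (y - star y)"
  have "cpos (a * a)" "cpos (b * b)"
    by (auto intro!: cpos_square simp: a_def b_def star_add star_scaleC star_diff star_star
        complex_vector.scale_minus_left complex_vector.scale_right_diff_distrib)
  then have "cpos ((1 / 2) *\<^sub>R (a * a + b * b))" by (intro cpos_scaleR cpos_add) auto
  also have "a * a + b * b = 2 *\<^sub>R (star y * y + y * star y)"
    by (simp add: a_def b_def algebra_simps scaleC_mult_left scaleC_mult_right scaleC_scaleC scaleC_one
        complex_vector.scale_minus_left scaleR_2)
  finally show ?thesis by simp
qed

text \<open>Suppose the spectrum of \<open>h = x\<^sup>*x\<close> has bottom \<open>-m < 0\<close>. Put \<open>y = x g\<close> with the resolvent
\<open>g = (h + 2m)\<^sup>-\<^sup>1\<close>. Then \<open>y\<^sup>*y\<close> is the value at \<open>h\<close> of the function \<open>s/(s + 2m)\<^sup>2\<close>, which is at most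
\<open>1/(8m)\<close> everywhere but equals \<open>-1/m\<close> at \<open>s = -m\<close>. The upper bound passes to \<open>y y\<^sup>*\<close>. Since
\<open>y\<^sup>*y + y y\<^sup>*\<close> is positive, it follows that \<open>y\<^sup>*y \<ge> -1/(8m)\<close>, so \<open>y\<^sup>*y + 1/m\<close> is invertible.
But \<open>h + m\<close> is a factor of the latter.\<close>

theorem cpos_star_mult:
  fixes x :: "'c::cstar_algebra"
  shows "cpos (star x * x)"
proof (rule ccontr)
  define h where "h = star x * x"
  assume "\<not> cpos (star x * x)"
  moreover have sh: "star h = h" by (simp add: h_def star_mult star_star)
  ultimately obtain m where m: "m > 0" "cpos (h + of_real m)" "\<not> invertible_elem (h + of_real m)"
    using not_cpos_spectral_bound[of h] by (auto simp: h_def)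
  obtain g where g: "inverse_pair (h + of_real m + of_real m) g"
    using invertible_elem_cpos_add[OF m(2,1)] by blast
  have hg: "g * h = h * g"
    by (rule inverse_pair_commute[OF g]) (simp add: algebra_simps of_real_def)
  have sg: "star g = g" by (rule inverse_pair_star[OF g]) (simp add: star_add sh)
  have hg1: "h * g = 1 - (2 * m) *\<^sub>R g"
    using g by (simp add: inverse_pair_def algebra_simps of_real_def scaleR_2 flip: scaleR_scaleR)
  define y where "y = x * g"
  have yy: "star y * y = g * h * g" by (simp add: y_def h_def star_mult sg mult.assoc)
  also have "\<dots> = g - (2 * m) *\<^sub>R (g * g)" unfolding hg hg1 by (simp add: algebra_simps)
  finally have yy: "star y * y = g - (2 * m) *\<^sub>R (g * g)" .
  define s where "s = 1 / (8 * m)"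
  have s: "s > 0" "s < 1 / m" using m by (auto simp: s_def field_simps)
  \<comment> \<open>p = (h - 2m)(h + 2m)^-1, and 1/(8m) - s/(s + 2m)^2 = (s - 2m)^2/(8m (s + 2m)^2)\<close>
  define p where "p = 1 - (4 * m) *\<^sub>R g"
  have "star p = p" by (simp add: p_def star_diff star_scaleR sg)
  then have "cpos (s *\<^sub>R (p * p))" using s by (intro cpos_scaleR cpos_square) auto
  also have "s *\<^sub>R (p * p) = of_real s - star y * y"
    using m unfolding yy by (simp add: p_def s_def algebra_simps of_real_def, simp flip: scaleR_left.add)
  finally have "cpos (of_real s - y * star y)" by (rule cpos_star_mult_swap) (use s in simp)
  from cpos_add[OF this cpos_symmetric_sum[of y]] have "cpos (star y * y + of_real s)"
    by (simp add: algebra_simps)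
  from invertible_elem_cpos_add[OF this, of "1 / m - s"] s
  have "invertible_elem (star y * y + of_real (1 / m))" by (simp add: algebra_simps)
  \<comment> \<open>the identity s/(s + 2m)^2 + 1/m = (s + m)(s + 4m)/(m (s + 2m)^2) at s = h\<close>
  also have "star y * y + of_real (1 / m) = (h + of_real m) * ((1 / m) *\<^sub>R (g + (2 * m) *\<^sub>R (g * g)))"
  proof -
    have hgg: "h * (g * g) = g - (2 * m) *\<^sub>R (g * g)"
      using arg_cong[OF hg1, of "\<lambda>z. z * g"] by (simp add: algebra_simps)
    have "(h + of_real m) * (g + (2 * m) *\<^sub>R (g * g))
        = h * g + m *\<^sub>R g + (2 * m) *\<^sub>R (h * (g * g)) + (2 * m * m) *\<^sub>R (g * g)"
      by (simp add: distrib_left distrib_right scaleR_add_right of_real_def mult.assoc)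
    also have "\<dots> = m *\<^sub>R (g - (2 * m) *\<^sub>R (g * g) + of_real (1 / m))"
      unfolding hg1 hgg using m
      by (simp add: scaleR_add_right scaleR_diff_right of_real_def)
        (simp add: algebra_simps flip: scaleR_left.add)
    finally show ?thesis using m unfolding yy by simp
  qed
  finally have inv: "invertible_elem ((h + of_real m) * ((1 / m) *\<^sub>R (g + (2 * m) *\<^sub>R (g * g))))" .
  have "h * (g * g) = g * g * h" by (metis hg mult.assoc)
  then have "invertible_elem (h + of_real m)"
    by (intro invertible_elem_commuting_factor[OF inv])
      (simp add: distrib_left distrib_right scaleR_add_right of_real_def hg)
  then show False using m by blast
qed

text \<open>With \<open>r = norm (p + q)\<close>, both \<open>p\<close> and \<open>r - p\<close> are positive, and their (shifted) roots have squares
summing to a scalar close to \<open>r\<close>.\<close>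

lemma cpos_norm_mono:
  assumes "cpos p" "cpos q"
  shows "norm p \<le> norm (p + q)"
proof (rule field_le_epsilon)
  fix \<epsilon> :: real assume \<epsilon>: "\<epsilon> > 0"
  define \<delta> where "\<delta> = \<epsilon> / 3"
  have \<delta>: "\<delta> > 0" using \<epsilon> by (simp add: \<delta>_def)
  define r where "r = norm (p + q)"
  have "cpos (of_real r - (p + q) + q)" unfolding r_def by (intro cpos_add cpos_norm_minus assms)
  then have "cpos (of_real r - p)" by simp
  from cpos_sqrt[OF this \<delta>] obtain e where e: "star e = e" "e * e = of_real r - p + of_real \<delta>"
    "\<And>z. z * (of_real r - p) = (of_real r - p) * z \<Longrightarrow> z * e = e * z" by blast
  obtain d where d: "star d = d" "d * d = p + of_real \<delta>" "\<And>z. z * p = p * z \<Longrightarrow> z * d = d * z"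
    using cpos_sqrt[OF assms(1) \<delta>] by blast
  have "p * d = d * p" by (rule d(3)) simp
  then have "d * e = e * d" by (intro e(3)) (simp add: algebra_simps of_real_def)
  moreover have "d * d + e * e = of_real (r + \<delta> + \<delta>)"
    by (simp only: d(2) e(2) of_real_add) (simp only: algebra_simps)
  ultimately have "norm (d * d) \<le> r + \<delta> + \<delta>"
    using norm_le_of_squares_sum[of d e "r + \<delta> + \<delta>"] d(1) e(1) \<delta> by (simp add: r_def)
  moreover have "p = d * d - of_real \<delta>" by (simp add: d(2))
  ultimately have "norm p \<le> r + 3 * \<delta>"
    using norm_triangle_ineq4[of "d * d" "of_real \<delta>"] \<delta> by simp
  then show "norm p \<le> norm (p + q) + \<epsilon>" by (simp add: r_def \<delta>_def)
qed


lemma cpos_sum_list: "(\<And>x. x \<in> set xs \<Longrightarrow> cpos (f x)) \<Longrightarrow> cpos (\<Sum>x\<leftarrow>xs. f x)"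
  using cpos_of_real[of 0] by (induction xs) (auto intro: cpos_add)

lemma norm_star_mult_le_sum_list:
  fixes x :: "'i \<Rightarrow> 'c::cstar_algebra"
  assumes "i \<in> set is"
  shows "(norm (x i))\<^sup>2 \<le> norm (\<Sum>j\<leftarrow>is. star (x j) * x j)"
proof -
  have "(\<Sum>j\<leftarrow>is. star (x j) * x j) = star (x i) * x i + (\<Sum>j\<leftarrow>remove1 i is. star (x j) * x j)"
    using assms by (rule sum_list_map_remove1)
  moreover have "norm (star (x i) * x i) \<le> norm (star (x i) * x i + (\<Sum>j\<leftarrow>remove1 i is. star (x j) * x j))"
    by (intro cpos_norm_mono cpos_sum_list cpos_star_mult)
  ultimately show ?thesis by (simp add: norm_star_mult)
qed

text \<open>The resolvents \<open>v = (w + \<epsilon>)\<^sup>-\<^sup>1\<close> stay bounded as \<open>\<epsilon>\<close> tends to \<open>0\<close>, and \<open>w v = 1 - \<epsilon> v\<close>.\<close>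

lemma cpos_bounded_below_invertible:
  fixes w :: "'c::cstar_algebra"
  assumes w: "cpos w" and \<delta>: "\<delta> > 0" and bound: "\<And>a. \<delta> * norm a \<le> norm (w * a)"
  shows "invertible_elem w"
proof -
  \<comment> \<open>a third suffices to get norm (\<epsilon> v) at most 1/2\<close>
  define \<epsilon> where "\<epsilon> = \<delta> / 3"
  have \<epsilon>: "\<epsilon> > 0" using \<delta> by (simp add: \<epsilon>_def)
  obtain v where v: "inverse_pair (w + of_real \<epsilon>) v"
    using invertible_elem_cpos_add[OF w \<epsilon>] by blast
  have wv: "w * v = 1 - \<epsilon> *\<^sub>R v" "v * w = 1 - \<epsilon> *\<^sub>R v"
    using v by (auto simp: inverse_pair_def of_real_def algebra_simps)
  have "\<delta> * norm v \<le> 1 + \<epsilon> * norm v"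
    using bound[of v] norm_triangle_ineq4[of 1 "\<epsilon> *\<^sub>R v"] \<epsilon> unfolding wv by simp
  then have "2 * (\<epsilon> * norm v) \<le> 1" by (simp add: \<epsilon>_def)
  then have "norm (1 - w * v) < 1" using \<epsilon> unfolding wv by simp
  from invertible_elem_near_one[OF this] show ?thesis
    by (rule invertible_elem_commuting_factor) (simp add: wv)
qed

lemma sum_list_mult_left: "(\<Sum>x\<leftarrow>xs. c * f x) = (c :: 'c::cstar_algebra) * (\<Sum>x\<leftarrow>xs. f x)"
  by (induction xs) (simp_all add: distrib_left)

lemma sum_list_mult_right: "(\<Sum>x\<leftarrow>xs. f x * c) = (\<Sum>x\<leftarrow>xs. f x) * (c :: 'c::cstar_algebra)"
  by (induction xs) (simp_all add: distrib_right)

lemma star_sum_list: "star (\<Sum>x\<leftarrow>xs. f x) = (\<Sum>x\<leftarrow>xs. star (f x :: 'c::cstar_algebra))"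
  by (induction xs) (simp_all add: star_add)

text \<open>This yields the invertibility of the index. With \<open>w\<close> the sum and
\<open>N\<^sup>2 = norm a \<cdot> norm (w a)\<close>, every \<open>u\<^sup>*a\<close> has norm at most \<open>N\<close>, because
\<open>(u\<^sup>*a)\<^sup>*(u\<^sup>*a)\<close> is one of the positive summands of \<open>a\<^sup>*w a\<close>. As \<open>a = \<Sum> b(u) u\<^sup>*a\<close>, the norm of
\<open>a\<close> is at most a constant times \<open>N\<close>, so \<open>w\<close> is bounded below.\<close>

theorem row_sum_invertible:
  fixes us :: "'c::cstar_algebra list"
  assumes "1 = (\<Sum>u\<leftarrow>us. b u * star u)"
  shows "invertible_elem (\<Sum>u\<leftarrow>us. u * star u)"
proof -
  define w where "w = (\<Sum>u\<leftarrow>us. u * star u)"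
  \<comment> \<open>the summand 1 only makes K nonzero\<close>
  define K where "K = (\<Sum>u\<leftarrow>us. norm (b u)) + 1"
  have K: "K > 0" unfolding K_def by (intro add_nonneg_pos sum_list_nonneg) auto
  have "cpos w" unfolding w_def using cpos_star_mult[of "star _"] by (intro cpos_sum_list) (simp add: star_star)
  moreover have "(1 / K\<^sup>2) * norm a \<le> norm (w * a)" for a
  proof -
    define N where "N = sqrt (norm a * norm (w * a))"
    have N0: "N \<ge> 0" by (simp add: N_def)
    have "norm (star u * a) \<le> N" if "u \<in> set us" for u
    proof -
      have "(norm (star u * a))\<^sup>2 \<le> norm (\<Sum>u\<leftarrow>us. star (star u * a) * (star u * a))"
        by (rule norm_star_mult_le_sum_list[OF that])
      also have "(\<Sum>u\<leftarrow>us. star (star u * a) * (star u * a)) = star a * w * a"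
        by (simp add: w_def star_mult star_star mult.assoc flip: sum_list_mult_left sum_list_mult_right)
      also have "norm \<dots> \<le> norm a * norm (w * a)"
        using norm_mult_ineq[of "star a" "w * a"] by (simp add: mult.assoc)
      finally show ?thesis unfolding N_def by (rule real_le_rsqrt)
    qed
    then have "(\<Sum>u\<leftarrow>us. norm (b u * (star u * a))) \<le> (\<Sum>u\<leftarrow>us. norm (b u) * N)"
      by (intro sum_list_mono order_trans[OF norm_mult_ineq mult_left_mono]) auto
    moreover have "norm (\<Sum>u\<leftarrow>us. b u * (star u * a)) \<le> (\<Sum>u\<leftarrow>us. norm (b u * (star u * a)))"
      by (induction us) (auto intro: order_trans[OF norm_triangle_ineq])
    ultimately have "norm (\<Sum>u\<leftarrow>us. b u * (star u * a)) \<le> (\<Sum>u\<leftarrow>us. norm (b u) * N)"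
      by linarith
    also have "\<dots> = (\<Sum>u\<leftarrow>us. norm (b u)) * N" by (simp add: sum_list_mult_const)
    also have "\<dots> \<le> K * N" using N0 by (simp add: K_def distrib_right)
    also have "(\<Sum>u\<leftarrow>us. b u * (star u * a)) = a"
      using assms by (simp add: sum_list_mult_right flip: mult.assoc)
    finally have "(norm a)\<^sup>2 \<le> (K * N)\<^sup>2" by (intro power_mono) auto
    then have "norm a * norm a \<le> norm a * (K\<^sup>2 * norm (w * a))"
      by (simp add: power_mult_distrib N_def power2_eq_square[of "norm a"] mult.assoc mult.left_commute)
    then have "norm a \<le> K\<^sup>2 * norm (w * a)" by (cases "norm a = 0") auto
    then show ?thesis using K by (simp add: field_simps)
  qed
  ultimately show ?thesis unfolding w_def[symmetric] using K
    by (intro cpos_bounded_below_invertible[of w "1 / K\<^sup>2"]) auto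
qed


section \<open>Finite sums and linear maps on subspaces\<close>

lemma sum_list_swap: "(\<Sum>x\<leftarrow>xs. \<Sum>y\<leftarrow>ys. f x y) = (\<Sum>y\<leftarrow>ys. \<Sum>x\<leftarrow>xs. f x y :: 'a::comm_monoid_add)"
  by (induction xs) (simp_all add: sum_list_addf)

lemma sum_list_apply: "(\<Sum>x\<leftarrow>xs. f x) z = (\<Sum>x\<leftarrow>xs. f x z :: 'a::monoid_add)"
  by (induction xs) simp_all

lemma csubspace_sum_list:
  "csubspace S \<Longrightarrow> (\<And>x. x \<in> set xs \<Longrightarrow> g x \<in> S) \<Longrightarrow> (\<Sum>x\<leftarrow>xs. g x) \<in> S"
  by (induction xs) (auto intro: complex_vector.subspace_0 complex_vector.subspace_add)

lemma clinear_on_zero: "csubspace S \<Longrightarrow> clinear_on S f \<Longrightarrow> f 0 = 0"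
  unfolding clinear_on_def
  by (metis complex_vector.scale_zero_left complex_vector.subspace_0)

lemma clinear_on_sum_list:
  assumes "csubspace S" "clinear_on S f" "\<And>x. x \<in> set xs \<Longrightarrow> g x \<in> S"
  shows "f (\<Sum>x\<leftarrow>xs. g x) = (\<Sum>x\<leftarrow>xs. f (g x))"
  using assms(3)
proof (induction xs)
  case (Cons x xs)
  then have "g x \<in> S" "(\<Sum>x\<leftarrow>xs. g x) \<in> S"
    using csubspace_sum_list[OF assms(1), of xs g] by auto
  then have "f (g x + (\<Sum>x\<leftarrow>xs. g x)) = f (g x) + f (\<Sum>x\<leftarrow>xs. g x)"
    using assms(2) by (simp add: clinear_on_def)
  then show ?case using Cons by simp
qed (simp add: clinear_on_zero[OF assms(1,2)])

lemma clinear_on_span_eq: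
  assumes "clinear_on (cspan G) f" "clinear_on (cspan G) g" "\<And>x. x \<in> G \<Longrightarrow> f x = g x"
    and "x \<in> cspan G"
  shows "f x = g x"
proof -
  have "x \<in> cspan G \<and> f x = g x"
    using assms(4)
  proof (induction rule: complex_vector.span_induct_alt)
    case base
    then show ?case
      using clinear_on_zero[OF complex_vector.subspace_span] assms(1,2)
      by (metis complex_vector.span_zero)
  next
    case (step c x y)
    have x: "x \<in> cspan G" by (rule complex_vector.span_base[OF step(1)])
    then have cx: "c *\<^sub>C x \<in> cspan G" by (rule complex_vector.span_scale)
    have "f (c *\<^sub>C x) = g (c *\<^sub>C x)"
      using x assms(1,2) assms(3)[OF step(1)] by (simp add: clinear_on_def)
    moreover have "f (c *\<^sub>C x + y) = f (c *\<^sub>C x) + f y" "g (c *\<^sub>C x + y) = g (c *\<^sub>C x) + g y"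
      using cx step(2) assms(1,2) by (simp_all add: clinear_on_def)
    ultimately show ?case using step(2) cx by (simp add: complex_vector.span_add)
  qed
  then show ?thesis ..
qed

lemma sum_list_scaleC: "(\<Sum>x\<leftarrow>xs. r *\<^sub>C f x) = r *\<^sub>C (\<Sum>x\<leftarrow>xs. f x :: 'a::complex_vector)"
  by (induction xs) (simp_all add: scaleC_add_right)

section \<open>Conditional expectations of finite index\<close>

lemma alg_inverse_eq:
  assumes "inverse_pair w v"
  shows "alg_inverse w = v"
  unfolding alg_inverse_def
  by (rule the_equality) (use assms inverse_pair_unique in \<open>auto simp: inverse_pair_def\<close>)

lemma jones_apply: "jones E a b z = a * E (b * z)"
  by (simp add: jones_def lmult_def)

locale finite_index_expectation =
  fixes A :: "'c::cstar_algebra set" and E :: "'c \<Rightarrow> 'c" and us :: "'c list"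
  assumes subalgebra: "unital_cstar_subalgebra A"
    and expectation: "conditional_expectation A E"
    and basis: "quasi_basis E us"
begin

lemma E_linear: "clinear_on UNIV E" and E_in: "E c \<in> A"
  and E_id: "a \<in> A \<Longrightarrow> E a = a"
  and E_left: "a \<in> A \<Longrightarrow> E (a * c) = a * E c"
  and E_right: "a \<in> A \<Longrightarrow> E (c * a) = E c * a"
  and E_positive: "positive_in (sub_alg A) (E (star c * c))"
  using expectation by (auto simp: conditional_expectation_def)

lemma one_in: "1 \<in> A" and star_in: "a \<in> A \<Longrightarrow> star a \<in> A"
  using subalgebra by (auto simp: unital_cstar_subalgebra_def)

lemma E_add: "E (x + y) = E x + E y" and E_scaleC: "E (r *\<^sub>C x) = r *\<^sub>C E x"
  using E_linear by (simp_all add: clinear_on_def)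

lemma E_zero: "E 0 = 0" using E_add[of 0 0] by simp

lemma E_minus: "E (- x) = - E x" using E_add[of x "- x"] E_zero by (simp add: add_eq_0_iff)

lemma E_sum_list: "E (\<Sum>x\<leftarrow>xs. f x) = (\<Sum>x\<leftarrow>xs. E (f x))"
  by (induction xs) (simp_all add: E_zero E_add)

lemma basis_left: "(\<Sum>u\<leftarrow>us. u * E (star u * c)) = c"
  and basis_right: "(\<Sum>u\<leftarrow>us. E (c * u) * star u) = c"
  using basis by (auto simp: quasi_basis_def)

text \<open>Positivity makes \<open>E (c\<^sup>*c)\<close> self-adjoint for all \<open>c\<close>; taking \<open>c = 1 + x\<close> and \<open>c = 1 + \<i>x\<close> separates
\<open>x\<close> from \<open>x\<^sup>*\<close>.\<close>

lemma E_star: "E (star x) = star (E x)"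
proof -
  have sa: "star (E (star c * c)) = E (star c * c)" for c
    using E_positive[of c] by (auto simp: positive_in_def sub_alg_def star_mult star_star)
  have polar: "star (E c) + star (E (star c)) = E c + E (star c)" for c
  proof -
    have "E (star (1 + c) * (1 + c)) = E 1 + E c + E (star c) + E (star c * c)"
      by (simp add: star_add distrib_left distrib_right E_add)
    moreover have "star (E 1) = E 1" using sa[of 1] by simp
    ultimately show ?thesis using sa[of "1 + c"] sa[of c] by (simp add: star_add algebra_simps)
  qed
  have "\<i> *\<^sub>C (star (E (star x)) - star (E x)) = \<i> *\<^sub>C (E x - E (star x))"
    using polar[of "\<i> *\<^sub>C x"]
    by (simp add: star_scaleC E_scaleC E_minus star_minus complex_vector.scale_minus_left complex_vector.scale_right_diff_distrib)
  then have "star (E (star x)) - star (E x) = E x - E (star x)"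
    by (simp only: complex_vector.scale_left_imp_eq[OF complex_i_not_zero])
  then have s2: "star (E (star x)) = E x - E (star x) + star (E x)"
    by (simp only: diff_eq_eq)
  have s1: "star (E (star x)) = E x + E (star x) - star (E x)"
    using polar[of x] by (simp add: algebra_simps)
  have "2 *\<^sub>R star (E (star x)) = 2 *\<^sub>R E x"
    using arg_cong2[OF s1 s2, of "(+)"] by (simp add: scaleR_2)
  then have "star (E (star x)) = E x" by simp
  then show ?thesis by (metis star_star)
qed

lemma E_nondegenerate:
  assumes "\<And>x. E (star x * s) = E (star x * t)"
  shows "s = t"
proof -
  have "(\<Sum>u\<leftarrow>us. u * E (star u * s)) = (\<Sum>u\<leftarrow>us. u * E (star u * t))"
    by (simp only: assms)
  then show ?thesis by (simp only: basis_left)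
qed

subsection \<open>The index\<close>

definition index :: 'c where "index = (\<Sum>u\<leftarrow>us. u * star u)"

definition index_inv :: 'c where "index_inv = alg_inverse (watatani_index E)"

text \<open>Independence of the quasi-basis: inserting the expansion of each \<open>x\<close> in the basis \<open>us\<close>, or of each \<open>u\<^sup>*\<close>
in \<open>ws\<close>, gives the same double sum \<open>\<Sum> u E(u\<^sup>*x) x\<^sup>*\<close>.\<close>

lemma watatani_index_eq: "watatani_index E = index"
  unfolding watatani_index_def
proof (rule the_equality)
  show "\<exists>us. quasi_basis E us \<and> index = (\<Sum>u\<leftarrow>us. u * star u)"
    using basis index_def by blast
next
  fix w assume "\<exists>ws. quasi_basis E ws \<and> w = (\<Sum>u\<leftarrow>ws. u * star u)"
  then obtain ws where ws: "quasi_basis E ws" "w = (\<Sum>x\<leftarrow>ws. x * star x)" by blast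
  have "index = (\<Sum>u\<leftarrow>us. \<Sum>x\<leftarrow>ws. u * E (star u * x) * star x)"
    using ws(1) by (simp add: index_def quasi_basis_def mult.assoc sum_list_mult_left)
  also have "\<dots> = (\<Sum>x\<leftarrow>ws. (\<Sum>u\<leftarrow>us. u * E (star u * x)) * star x)"
    by (subst sum_list_swap) (simp add: sum_list_mult_right)
  also have "\<dots> = w" by (simp add: basis_left ws(2))
  finally show "w = index" ..
qed

lemma index_central: "index * c = c * index"
proof -
  have "c * index = (\<Sum>u\<leftarrow>us. (\<Sum>x\<leftarrow>us. x * E (star x * (c * u))) * star u)"
    by (simp add: index_def basis_left mult.assoc sum_list_mult_left)
  also have "\<dots> = (\<Sum>x\<leftarrow>us. x * (\<Sum>u\<leftarrow>us. E ((star x * c) * u) * star u))"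
    by (simp only: flip: sum_list_mult_right sum_list_mult_left) (subst sum_list_swap, simp only: mult.assoc)
  also have "\<dots> = index * c"
    by (simp only: basis_right) (simp add: index_def sum_list_mult_right flip: mult.assoc)
  finally show ?thesis ..
qed

lemma index_star: "star index = index"
  by (simp add: index_def star_sum_list star_mult star_star)

lemma index_inverse: "inverse_pair index index_inv"
proof -
  have "1 = (\<Sum>u\<leftarrow>us. E u * star u)" using basis_right[of 1] by simp
  from row_sum_invertible[OF this] obtain v where v: "inverse_pair index v"
    unfolding index_def by blast
  then show ?thesis using alg_inverse_eq[OF v] by (simp add: index_inv_def watatani_index_eq)
qed

lemma index_inv_left: "index_inv * index = 1" and index_inv_right: "index * index_inv = 1"
  using index_inverse by (auto simp: inverse_pair_def)

lemma index_inv_central: "index_inv * c = c * index_inv"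
  by (rule inverse_pair_commute[OF index_inverse index_central])

lemma index_inv_star: "star index_inv = index_inv"
  by (rule inverse_pair_star[OF index_inverse index_star])

subsection \<open>The basic construction\<close>

abbreviation C1 :: "('c \<Rightarrow> 'c) set" where "C1 \<equiv> acar (basic_construction E)"

lemma C1_eq: "C1 = cspan {jones E c1 c2 | c1 c2. True}"
  by (simp add: basic_construction_def)

lemma C1_subspace: "csubspace C1"
  unfolding C1_eq by (rule complex_vector.subspace_span)

lemma jones_in: "jones E a b \<in> C1"
  unfolding C1_eq by (rule complex_vector.span_base) blast

lemma lmult_eq_sum: "lmult c = (\<Sum>u\<leftarrow>us. jones E (c * u) (star u))"
  by (rule ext) (simp add: sum_list_apply jones_apply lmult_def mult.assoc sum_list_mult_left basis_left)

lemma lmult_in: "lmult c \<in> C1"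
  unfolding lmult_eq_sum by (intro csubspace_sum_list C1_subspace jones_in)

text \<open>Operators in the basic construction are right linear over \<open>A\<close>, so they commute with the expansion of
\<open>z\<close> in the quasi-basis.\<close>

lemma C1_expand: "T \<in> C1 \<Longrightarrow> T z = (\<Sum>u\<leftarrow>us. T u * E (star u * z))"
  unfolding C1_eq
proof (rule clinear_on_span_eq[of _ "\<lambda>T. T z" "\<lambda>T. \<Sum>u\<leftarrow>us. T u * E (star u * z)"])
  show "clinear_on (cspan {jones E c1 c2 |c1 c2. True}) (\<lambda>T. T z)"
    by (simp add: clinear_on_def scaleC_fun_def)
  show "clinear_on (cspan {jones E c1 c2 |c1 c2. True}) (\<lambda>T. \<Sum>u\<leftarrow>us. T u * E (star u * z))"
    by (simp add: clinear_on_def scaleC_fun_def distrib_right sum_list_addf scaleC_mult_left sum_list_scaleC)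
  show "T z = (\<Sum>u\<leftarrow>us. T u * E (star u * z))" if "T \<in> {jones E c1 c2 |c1 c2. True}" for T
  proof -
    from that obtain a b where T: "T = jones E a b" by blast
    have "b * z = (\<Sum>u\<leftarrow>us. b * u * E (star u * z))"
      by (simp add: mult.assoc sum_list_mult_left basis_left)
    then have "E (b * z) = (\<Sum>u\<leftarrow>us. E (b * u) * E (star u * z))"
      by (simp add: E_sum_list E_right E_in)
    then show ?thesis by (simp add: T jones_apply mult.assoc sum_list_mult_left)
  qed
qed

text \<open>\<open>adjoint_op\<close> is a definite description. Its defining property is isolated so that existence and
uniqueness of the adjoint can be established first.\<close>

definition adjoint_pair :: "('c \<Rightarrow> 'c) \<Rightarrow> ('c \<Rightarrow> 'c) \<Rightarrow> bool" where
  "adjoint_pair T S \<longleftrightarrow> (\<forall>x y. E (star (T x) * y) = E (star x * S y))"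

lemma adjoint_op_eq: "adjoint_pair T S \<Longrightarrow> adjoint_op E T = S"
  unfolding adjoint_op_def
proof (rule the_equality)
  fix S' assume S: "adjoint_pair T S" and S': "\<forall>x y. E (star (T x) * y) = E (star x * S' y)"
  show "S' = S"
  proof
    fix y show "S' y = S y" by (rule E_nondegenerate) (use S S' in \<open>simp add: adjoint_pair_def\<close>)
  qed
qed (simp add: adjoint_pair_def)

lemma adjoint_jones: "adjoint_op E (jones E a b) = jones E (star b) (star a)"
proof (rule adjoint_op_eq, unfold adjoint_pair_def, intro allI)
  fix x y
  have "E (star (a * E (b * x)) * y) = star (E (b * x)) * E (star a * y)"
    by (simp add: star_mult mult.assoc E_left star_in E_in)
  also have "\<dots> = E (star x * (star b * E (star a * y)))"
    by (simp add: E_right E_in star_mult flip: mult.assoc E_star)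
  finally show "E (star (jones E a b x) * y) = E (star x * jones E (star b) (star a) y)"
    by (simp add: jones_apply)
qed

lemma adjoint_lmult: "adjoint_op E (lmult c) = lmult (star c)"
  by (rule adjoint_op_eq) (simp add: adjoint_pair_def lmult_def star_mult mult.assoc)

text \<open>The adjoint of \<open>T\<close> is \<open>y \<mapsto> \<Sum> u E((T u)\<^sup>* y)\<close>, by \<open>C1_expand\<close>.\<close>

lemma adjoint_pair_exists: "T \<in> C1 \<Longrightarrow> adjoint_pair T (adjoint_op E T)"
proof -
  assume T: "T \<in> C1"
  define S where "S y = (\<Sum>u\<leftarrow>us. u * E (star (T u) * y))" for y
  have "adjoint_pair T S"
    unfolding adjoint_pair_def
  proof (intro allI)
    fix x y
    have "E (star (T x) * y) = (\<Sum>u\<leftarrow>us. E (star x * u) * E (star (T u) * y))"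
      by (subst C1_expand[OF T])
        (simp add: star_sum_list star_mult star_star mult.assoc E_sum_list E_left E_in
          flip: sum_list_mult_right E_star)
    also have "\<dots> = E (star x * S y)"
      by (simp add: S_def E_sum_list E_right E_in flip: sum_list_mult_left mult.assoc)
    finally show "E (star (T x) * y) = E (star x * S y)" .
  qed
  then show ?thesis using adjoint_op_eq by metis
qed

text \<open>The right-hand side is linear in \<open>T\<close> and takes the prescribed values on the generators, so the choice in
\<open>dual_expectation\<close> is from a nonempty set; since the generators span, it is also unique. The formula gives
access to all of \<open>C\<^sub>1\<close> without induction over the span.\<close>

lemma dual_expectation_eq:
  "T \<in> C1 \<Longrightarrow> dual_expectation E T = index_inv * (\<Sum>u\<leftarrow>us. T u * star u)"
proof -
  let ?F = "\<lambda>T. index_inv * (\<Sum>u\<leftarrow>us. T u * star u)"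
  let ?spec = "\<lambda>F. clinear_on C1 F \<and>
     (\<forall>c1 c2. F (jones E c1 c2) = alg_inverse (watatani_index E) * c1 * c2)"
  have lin: "clinear_on C1 ?F"
    by (simp add: clinear_on_def scaleC_fun_def distrib_right distrib_left sum_list_addf
        scaleC_mult_left scaleC_mult_right sum_list_scaleC)
  moreover have "?F (jones E a b) = alg_inverse (watatani_index E) * a * b" for a b
    by (simp add: jones_apply mult.assoc sum_list_mult_left basis_right flip: index_inv_def)
  ultimately have F: "?spec ?F" by blast
  then have D: "?spec (dual_expectation E)"
    unfolding dual_expectation_def by (rule someI[of ?spec])
  assume T: "T \<in> C1"
  show ?thesis
  proof (rule clinear_on_span_eq[of "{jones E c1 c2 | c1 c2. True}" "dual_expectation E" ?F])
    show "clinear_on (cspan {jones E c1 c2 | c1 c2. True}) (dual_expectation E)"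
      using D unfolding C1_eq by blast
    show "clinear_on (cspan {jones E c1 c2 | c1 c2. True}) ?F" using lin unfolding C1_eq by blast
    show "T \<in> cspan {jones E c1 c2 | c1 c2. True}" using T unfolding C1_eq by blast
    show "dual_expectation E T = ?F T" if "T \<in> {jones E c1 c2 | c1 c2. True}" for T
      using that D F by force
  qed
qed

lemma dual_expectation_linear: "clinear_on C1 (dual_expectation E)"
proof -
  have "S + T \<in> C1" "r *\<^sub>C S \<in> C1" if "S \<in> C1" "T \<in> C1" for S T r
    using that C1_subspace by (auto intro: complex_vector.subspace_add complex_vector.subspace_scale)
  then show ?thesis
    by (simp add: clinear_on_def dual_expectation_eq scaleC_fun_def distrib_right distrib_left sum_list_addf
        scaleC_mult_left scaleC_mult_right sum_list_scaleC)
qed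

lemma dual_expectation_jones: "dual_expectation E (jones E a b) = index_inv * a * b"
  by (simp add: dual_expectation_eq jones_in jones_apply mult.assoc sum_list_mult_left basis_right)

text \<open>The right-handed form of the formula, needed because \<open>D\<^sub>1\<close> acts on \<open>Y\<^sub>1\<close> through adjoints.\<close>

lemma dual_expectation_adjoint:
  assumes T: "T \<in> C1"
  shows "dual_expectation E T = index_inv * (\<Sum>u\<leftarrow>us. u * star (adjoint_op E T u))"
proof -
  let ?S = "adjoint_op E T"
  have flip: "E (star x * T y) = E (star (?S x) * y)" for x y
    using adjoint_pair_exists[OF T] unfolding adjoint_pair_def
    by (metis E_star star_mult star_star)
  have "(\<Sum>u\<leftarrow>us. T u * star u) = (\<Sum>u\<leftarrow>us. (\<Sum>x\<leftarrow>us. x * E (star x * T u)) * star u)"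
    by (simp add: basis_left)
  also have "\<dots> = (\<Sum>x\<leftarrow>us. x * (\<Sum>u\<leftarrow>us. E (star (?S x) * u) * star u))"
    by (simp only: flip: sum_list_mult_right sum_list_mult_left) (subst sum_list_swap, simp only: flip mult.assoc)
  finally show ?thesis by (simp add: dual_expectation_eq[OF T] basis_right)
qed

lemma dual_expectation_star:
  assumes "T \<in> C1" "adjoint_op E T \<in> C1"
  shows "dual_expectation E (adjoint_op E T) = star (dual_expectation E T)"
  unfolding dual_expectation_adjoint[OF assms(1)] dual_expectation_eq[OF assms(2)]
  by (simp add: star_mult star_sum_list star_star index_inv_star index_inv_central)

end


section \<open>Equivalence bimodules\<close>

text \<open>A dense left ideal contains an element close to \<open>1\<close>, hence a left invertible one. Fullness of a bimodule
over a unital algebra thus holds without closure.\<close>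

lemma unit_in_dense_left_ideal:
  fixes f :: "'p \<Rightarrow> 'c::cstar_algebra"
  assumes dense: "closure (cspan (f ` P)) = UNIV"
    and ideal: "\<And>h p. p \<in> P \<Longrightarrow> h * f p \<in> f ` P"
  shows "\<exists>ps. set ps \<subseteq> P \<and> (\<Sum>p\<leftarrow>ps. f p) = 1"
proof -
  obtain g where g: "g \<in> cspan (f ` P)" "norm (1 - g) < 1"
    using closure_approachable[of 1 "cspan (f ` P)"] dense
    by (metis UNIV_I dist_norm norm_minus_commute zero_less_one)
  obtain h where h: "h * g = 1"
    using invertible_elem_near_one[OF g(2)] by (auto simp: inverse_pair_def)
  have "\<exists>ps. set ps \<subseteq> P \<and> (\<Sum>p\<leftarrow>ps. f p) = h * g"
    using g(1)
  proof (induction rule: complex_vector.span_induct_alt)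
    case base
    show ?case by (rule exI[of _ "[]"]) simp
  next
    case (step c x y)
    then obtain ps where ps: "set ps \<subseteq> P" "(\<Sum>p\<leftarrow>ps. f p) = h * y" by blast
    obtain q where q: "q \<in> P" "(c *\<^sub>C h) * x = f q" using step(1) ideal by blast
    have "h * (c *\<^sub>C x + y) = f q + h * y"
      by (simp add: distrib_left scaleC_mult_left scaleC_mult_right flip: q(2))
    then show ?case using ps q(1) by (intro exI[of _ "q # ps"]) simp
  qed
  then show ?thesis using h by simp
qed

locale equiv_bimodule =
  fixes M :: "('l::complex_vector, 'r::complex_vector, 'y::complex_vector) bimodule"
  assumes equivalence: "equivalence_bimodule M"
begin

lemma left_module: "full_left_hilbert_module M" and right_module: "full_right_hilbert_module M"
  using equivalence by (simp_all add: equivalence_bimodule_def)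

lemma carrier_subspace: "csubspace (bcar M)"
  and lact_in: "a \<in> acar (lalg M) \<Longrightarrow> x \<in> bcar M \<Longrightarrow> lact M a x \<in> bcar M"
  and lact_linear: "a \<in> acar (lalg M) \<Longrightarrow> clinear_on (bcar M) (lact M a)"
  and lact_linear_alg: "x \<in> bcar M \<Longrightarrow> clinear_on (acar (lalg M)) (\<lambda>a. lact M a x)"
  and lact_mult: "a \<in> acar (lalg M) \<Longrightarrow> b \<in> acar (lalg M) \<Longrightarrow> x \<in> bcar M \<Longrightarrow>
    lact M (amult (lalg M) a b) x = lact M a (lact M b x)"
  and lact_one: "x \<in> bcar M \<Longrightarrow> lact M (aone (lalg M)) x = x"
  and linner_in: "x \<in> bcar M \<Longrightarrow> y \<in> bcar M \<Longrightarrow> linner M x y \<in> acar (lalg M)"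
  and linner_linear: "y \<in> bcar M \<Longrightarrow> clinear_on (bcar M) (\<lambda>x. linner M x y)"
  and linner_lact: "a \<in> acar (lalg M) \<Longrightarrow> x \<in> bcar M \<Longrightarrow> y \<in> bcar M \<Longrightarrow>
    linner M (lact M a x) y = amult (lalg M) a (linner M x y)"
  and linner_star: "x \<in> bcar M \<Longrightarrow> y \<in> bcar M \<Longrightarrow> astar (lalg M) (linner M x y) = linner M y x"
  using left_module by (simp_all add: full_left_hilbert_module_def)

lemma ract_in: "b \<in> acar (ralg M) \<Longrightarrow> x \<in> bcar M \<Longrightarrow> ract M x b \<in> bcar M"
  and ract_linear: "b \<in> acar (ralg M) \<Longrightarrow> clinear_on (bcar M) (\<lambda>x. ract M x b)"
  and ract_linear_alg: "x \<in> bcar M \<Longrightarrow> clinear_on (acar (ralg M)) (ract M x)"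
  and ract_mult: "a \<in> acar (ralg M) \<Longrightarrow> b \<in> acar (ralg M) \<Longrightarrow> x \<in> bcar M \<Longrightarrow>
    ract M x (amult (ralg M) a b) = ract M (ract M x a) b"
  and ract_one: "x \<in> bcar M \<Longrightarrow> ract M x (aone (ralg M)) = x"
  and rinner_in: "x \<in> bcar M \<Longrightarrow> y \<in> bcar M \<Longrightarrow> rinner M x y \<in> acar (ralg M)"
  and rinner_linear: "x \<in> bcar M \<Longrightarrow> clinear_on (bcar M) (rinner M x)"
  and rinner_ract: "b \<in> acar (ralg M) \<Longrightarrow> x \<in> bcar M \<Longrightarrow> y \<in> bcar M \<Longrightarrow>
    rinner M x (ract M y b) = amult (ralg M) (rinner M x y) b"
  and rinner_star: "x \<in> bcar M \<Longrightarrow> y \<in> bcar M \<Longrightarrow> astar (ralg M) (rinner M x y) = rinner M y x"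
  using right_module by (simp_all add: full_right_hilbert_module_def)

lemma act_assoc: "a \<in> acar (lalg M) \<Longrightarrow> b \<in> acar (ralg M) \<Longrightarrow> x \<in> bcar M \<Longrightarrow>
    ract M (lact M a x) b = lact M a (ract M x b)"
  and rinner_lact: "a \<in> acar (lalg M) \<Longrightarrow> x \<in> bcar M \<Longrightarrow> y \<in> bcar M \<Longrightarrow>
    rinner M (lact M a x) y = rinner M x (lact M (astar (lalg M) a) y)"
  and linner_ract: "b \<in> acar (ralg M) \<Longrightarrow> x \<in> bcar M \<Longrightarrow> y \<in> bcar M \<Longrightarrow>
    linner M (ract M x b) y = linner M x (ract M y (astar (ralg M) b))"
  and imprimitivity: "x \<in> bcar M \<Longrightarrow> y \<in> bcar M \<Longrightarrow> z \<in> bcar M \<Longrightarrow>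
    lact M (linner M x y) z = ract M x (rinner M y z)"
  using equivalence by (simp_all add: equivalence_bimodule_def)

end

locale expected_inclusion =
  L: finite_index_expectation A E\<^sub>A us + R: finite_index_expectation B E\<^sub>B vs
  for A :: "'c::cstar_algebra set" and E\<^sub>A us
    and B :: "'d::cstar_algebra set" and E\<^sub>B vs +
  fixes Y :: "('c, 'd, 'y::complex_vector) bimodule" and X :: "'y set" and E\<^sub>X :: "'y \<Rightarrow> 'y"
  assumes morita: "strongly_morita_equivalent A B Y X"
    and bimodule_expectation: "bimodule_conditional_expectation A B E\<^sub>A E\<^sub>B Y X E\<^sub>X"
begin

abbreviation left_action (infixr "\<rhd>" 73) where "c \<rhd> y \<equiv> lact Y c y"
abbreviation right_action (infixl "\<lhd>" 74) where "y \<lhd> d \<equiv> ract Y y d"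
abbreviation lip where "lip \<equiv> linner Y"
abbreviation rip where "rip \<equiv> rinner Y"
abbreviation carrier where "carrier \<equiv> bcar Y"

lemma algebras [simp]: "lalg Y = sub_alg UNIV" "ralg Y = sub_alg UNIV"
  using morita by (simp_all add: strongly_morita_equivalent_def)

lemma sub_alg_simps [simp]: "acar (sub_alg S) = S" "amult (sub_alg S) = (*)" "aone (sub_alg S) = 1"
  "astar (sub_alg S) = star"
  by (simp_all add: sub_alg_def)

sublocale Y: equiv_bimodule Y
  by unfold_locales (use morita in \<open>simp add: strongly_morita_equivalent_def\<close>)

lemma X_subset: "x \<in> X \<Longrightarrow> x \<in> carrier"
  using morita by (auto simp: strongly_morita_equivalent_def closed_wrt_def)

lemma ract_X: "b \<in> B \<Longrightarrow> x \<in> X \<Longrightarrow> x \<lhd> b \<in> X"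
  using morita by (auto simp: strongly_morita_equivalent_def)

lemma lact_in [simp]: "x \<in> carrier \<Longrightarrow> c \<rhd> x \<in> carrier"
  and ract_in [simp]: "x \<in> carrier \<Longrightarrow> x \<lhd> d \<in> carrier"
  and lact_mult: "x \<in> carrier \<Longrightarrow> (c * c') \<rhd> x = c \<rhd> c' \<rhd> x"
  and ract_mult: "x \<in> carrier \<Longrightarrow> x \<lhd> (d * d') = x \<lhd> d \<lhd> d'"
  and lact_one: "x \<in> carrier \<Longrightarrow> 1 \<rhd> x = x"
  and ract_one: "x \<in> carrier \<Longrightarrow> x \<lhd> 1 = x"
  and act_assoc: "x \<in> carrier \<Longrightarrow> (c \<rhd> x) \<lhd> d = c \<rhd> x \<lhd> d"
  by (fact Y.lact_in[simplified] Y.ract_in[simplified] Y.lact_mult[simplified] Y.ract_mult[simplified]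
      Y.lact_one[simplified] Y.ract_one[simplified] Y.act_assoc[simplified])+

lemma lip_lact: "x \<in> carrier \<Longrightarrow> y \<in> carrier \<Longrightarrow> lip (c \<rhd> x) y = c * lip x y"
  and rip_ract: "x \<in> carrier \<Longrightarrow> y \<in> carrier \<Longrightarrow> rip x (y \<lhd> d) = rip x y * d"
  and lip_ract: "x \<in> carrier \<Longrightarrow> y \<in> carrier \<Longrightarrow> lip (x \<lhd> d) y = lip x (y \<lhd> star d)"
  and rip_lact: "x \<in> carrier \<Longrightarrow> y \<in> carrier \<Longrightarrow> rip (c \<rhd> x) y = rip x (star c \<rhd> y)"
  and lip_star: "x \<in> carrier \<Longrightarrow> y \<in> carrier \<Longrightarrow> star (lip x y) = lip y x"
  and rip_star: "x \<in> carrier \<Longrightarrow> y \<in> carrier \<Longrightarrow> star (rip x y) = rip y x"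
  and imprimitivity: "x \<in> carrier \<Longrightarrow> y \<in> carrier \<Longrightarrow> z \<in> carrier \<Longrightarrow> lip x y \<rhd> z = x \<lhd> rip y z"
  by (fact Y.linner_lact[simplified] Y.rinner_ract[simplified] Y.linner_ract[simplified]
      Y.rinner_lact[simplified] Y.linner_star[simplified] Y.rinner_star[simplified]
      Y.imprimitivity[simplified])+

lemma rip_ract_left: "x \<in> carrier \<Longrightarrow> y \<in> carrier \<Longrightarrow> rip (x \<lhd> d) y = star d * rip x y"
  by (subst rip_star[symmetric]) (simp_all add: rip_ract star_mult rip_star)

lemma lact_sum_list:
  "(\<And>i. i \<in> set is \<Longrightarrow> g i \<in> carrier) \<Longrightarrow> c \<rhd> (\<Sum>i\<leftarrow>is. g i) = (\<Sum>i\<leftarrow>is. c \<rhd> g i)"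
  by (rule clinear_on_sum_list[OF Y.carrier_subspace Y.lact_linear]) simp_all

lemma ract_sum_list:
  "(\<And>i. i \<in> set is \<Longrightarrow> g i \<in> carrier) \<Longrightarrow> (\<Sum>i\<leftarrow>is. g i) \<lhd> d = (\<Sum>i\<leftarrow>is. g i \<lhd> d)"
  by (rule clinear_on_sum_list[OF Y.carrier_subspace Y.ract_linear]) simp_all

lemma lact_sum_list_left: "y \<in> carrier \<Longrightarrow> (\<Sum>i\<leftarrow>is. c i) \<rhd> y = (\<Sum>i\<leftarrow>is. c i \<rhd> y)"
  by (rule clinear_on_sum_list[OF complex_vector.subspace_UNIV, of "\<lambda>c. c \<rhd> y"])
    (use Y.lact_linear_alg in simp_all)

lemma ract_sum_list_right: "y \<in> carrier \<Longrightarrow> y \<lhd> (\<Sum>i\<leftarrow>is. d i) = (\<Sum>i\<leftarrow>is. y \<lhd> d i)"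
  by (rule clinear_on_sum_list[OF complex_vector.subspace_UNIV])
    (use Y.ract_linear_alg in simp_all)

lemma lip_sum_list:
  "(\<And>i. i \<in> set is \<Longrightarrow> g i \<in> carrier) \<Longrightarrow> y \<in> carrier \<Longrightarrow> lip (\<Sum>i\<leftarrow>is. g i) y = (\<Sum>i\<leftarrow>is. lip (g i) y)"
  by (rule clinear_on_sum_list[OF Y.carrier_subspace Y.linner_linear]) simp_all

lemma rip_sum_list:
  "(\<And>i. i \<in> set is \<Longrightarrow> g i \<in> carrier) \<Longrightarrow> y \<in> carrier \<Longrightarrow> rip y (\<Sum>i\<leftarrow>is. g i) = (\<Sum>i\<leftarrow>is. rip y (g i))"
  by (rule clinear_on_sum_list[OF Y.carrier_subspace Y.rinner_linear]) simp_all

lemma E\<^sub>X_linear: "clinear_on carrier E\<^sub>X"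
  and E\<^sub>X_image: "E\<^sub>X ` carrier = X"
  and E\<^sub>X_lact: "x \<in> X \<Longrightarrow> E\<^sub>X (c \<rhd> x) = E\<^sub>A c \<rhd> x"
  and E\<^sub>X_left: "a \<in> A \<Longrightarrow> y \<in> carrier \<Longrightarrow> E\<^sub>X (a \<rhd> y) = a \<rhd> E\<^sub>X y"
  and E\<^sub>X_ract: "x \<in> X \<Longrightarrow> E\<^sub>X (x \<lhd> d) = x \<lhd> E\<^sub>B d"
  and E\<^sub>X_right: "b \<in> B \<Longrightarrow> y \<in> carrier \<Longrightarrow> E\<^sub>X (y \<lhd> b) = E\<^sub>X y \<lhd> b"
  and E\<^sub>B_rip: "y \<in> carrier \<Longrightarrow> x \<in> X \<Longrightarrow> E\<^sub>B (rip y x) = rip (E\<^sub>X y) x"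
  using bimodule_expectation by (auto simp: bimodule_conditional_expectation_def)

lemma E\<^sub>X_in: "y \<in> carrier \<Longrightarrow> E\<^sub>X y \<in> X"
  using E\<^sub>X_image by blast

lemma E\<^sub>X_in_carrier [simp]: "y \<in> carrier \<Longrightarrow> E\<^sub>X y \<in> carrier"
  by (simp add: E\<^sub>X_in X_subset)

lemma E\<^sub>X_sum_list:
  "(\<And>i. i \<in> set is \<Longrightarrow> g i \<in> carrier) \<Longrightarrow> E\<^sub>X (\<Sum>i\<leftarrow>is. g i) = (\<Sum>i\<leftarrow>is. E\<^sub>X (g i))"
  by (rule clinear_on_sum_list[OF Y.carrier_subspace E\<^sub>X_linear])

text \<open>Finite families of pairs whose inner products sum to the unit; they turn statements about \<open>Y\<close> into
statements about \<open>C\<cdot>X\<close> or \<open>X\<cdot>D\<close>, where \<open>E\<^sub>X\<close> is expressed by \<open>E\<^sub>A\<close> or \<open>E\<^sub>B\<close>.\<close>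

lemma left_frame: "\<exists>ps. set ps \<subseteq> carrier \<times> X \<and> (\<Sum>p\<leftarrow>ps. lip (fst p) (snd p)) = 1"
proof (rule unit_in_dense_left_ideal)
  have "(\<lambda>p. lip (fst p) (snd p)) ` (carrier \<times> X) = {lip y x |y x. y \<in> carrier \<and> x \<in> X}"
    by force
  then show "closure (cspan ((\<lambda>p. lip (fst p) (snd p)) ` (carrier \<times> X))) = UNIV"
    using morita by (simp add: strongly_morita_equivalent_def)
  fix h p assume "p \<in> carrier \<times> X"
  then show "h * lip (fst p) (snd p) \<in> (\<lambda>p. lip (fst p) (snd p)) ` (carrier \<times> X)"
    by (intro image_eqI[of _ _ "(h \<rhd> fst p, snd p)"]) (auto simp: lip_lact X_subset)
qed

lemma right_frame: "\<exists>ps. set ps \<subseteq> carrier \<times> X \<and> (\<Sum>p\<leftarrow>ps. rip (fst p) (snd p)) = 1"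
proof (rule unit_in_dense_left_ideal)
  have "(\<lambda>p. rip (fst p) (snd p)) ` (carrier \<times> X) = {rip y x |y x. y \<in> carrier \<and> x \<in> X}"
    by force
  then show "closure (cspan ((\<lambda>p. rip (fst p) (snd p)) ` (carrier \<times> X))) = UNIV"
    using morita by (simp add: strongly_morita_equivalent_def)
  fix h p assume "p \<in> carrier \<times> X"
  then show "h * rip (fst p) (snd p) \<in> (\<lambda>p. rip (fst p) (snd p)) ` (carrier \<times> X)"
    by (intro image_eqI[of _ _ "(fst p \<lhd> star h, snd p)"]) (auto simp: rip_ract_left X_subset star_star)
qed

lemma frame_mem:
  assumes "set ps \<subseteq> carrier \<times> X" "p \<in> set ps"
  shows "fst p \<in> carrier" "snd p \<in> X" "snd p \<in> carrier"
  using subsetD[OF assms] by (auto simp: mem_Times_iff X_subset)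

text \<open>For \<open>y = c\<cdot>x\<close> with \<open>x \<in> X\<close> this is the quasi-basis identity for \<open>E\<^sub>A\<close>. A general \<open>y\<close> is
\<open>\<Sum> y\<cdot>\<langle>z, x\<rangle> = \<Sum> \<langle>y, z\<rangle>\<cdot>x\<close> for a frame of pairs \<open>(z, x)\<close>.\<close>

lemma left_expansion:
  assumes y: "y \<in> carrier"
  shows "(\<Sum>u\<leftarrow>us. u \<rhd> E\<^sub>X (star u \<rhd> y)) = y"
proof -
  obtain ps where ps: "set ps \<subseteq> carrier \<times> X" "(\<Sum>p\<leftarrow>ps. rip (fst p) (snd p)) = 1"
    using right_frame by blast
  note mem = frame_mem[OF ps(1)]
  define f where "f p = lip y (fst p) \<rhd> snd p" for p
  have f: "f p \<in> carrier" if "p \<in> set ps" for p using mem[OF that] by (simp add: f_def)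
  have y_eq: "(\<Sum>p\<leftarrow>ps. f p) = y"
  proof -
    have "(\<Sum>p\<leftarrow>ps. f p) = (\<Sum>p\<leftarrow>ps. y \<lhd> rip (fst p) (snd p))"
      using mem y by (simp add: f_def imprimitivity cong: map_cong)
    also have "\<dots> = y" using y by (simp add: ps(2) ract_one flip: ract_sum_list_right)
    finally show ?thesis .
  qed
  have on_X: "(\<Sum>u\<leftarrow>us. u \<rhd> E\<^sub>X (star u \<rhd> c \<rhd> x)) = c \<rhd> x" if "x \<in> X" for c x
  proof -
    have "(\<Sum>u\<leftarrow>us. u \<rhd> E\<^sub>X (star u \<rhd> c \<rhd> x)) = (\<Sum>u\<leftarrow>us. u * E\<^sub>A (star u * c)) \<rhd> x"
      using that X_subset[OF that] by (simp add: lact_sum_list_left E\<^sub>X_lact flip: lact_mult)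
    then show ?thesis by (simp add: L.basis_left)
  qed
  have "(\<Sum>u\<leftarrow>us. u \<rhd> E\<^sub>X (star u \<rhd> (\<Sum>p\<leftarrow>ps. f p))) = (\<Sum>u\<leftarrow>us. \<Sum>p\<leftarrow>ps. u \<rhd> E\<^sub>X (star u \<rhd> f p))"
    using f by (simp add: lact_sum_list E\<^sub>X_sum_list)
  also have "\<dots> = (\<Sum>p\<leftarrow>ps. f p)"
    using mem by (subst sum_list_swap) (simp add: f_def on_X cong: map_cong)
  finally show ?thesis unfolding y_eq .
qed

text \<open>The mirror image of \<open>left_expansion\<close>, using that \<open>y = \<Sum> \<langle>x, z\<rangle>\<cdot>y = \<Sum> x\<cdot>\<langle>z, y\<rangle>\<close> is a sum of
elements of \<open>X\<cdot>D\<close>.\<close>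

lemma right_expansion:
  assumes y: "y \<in> carrier"
  shows "(\<Sum>v\<leftarrow>vs. E\<^sub>X (y \<lhd> v) \<lhd> star v) = y"
proof -
  obtain ps where ps: "set ps \<subseteq> carrier \<times> X" "(\<Sum>p\<leftarrow>ps. lip (fst p) (snd p)) = 1"
    using left_frame by blast
  note mem = frame_mem[OF ps(1)]
  define f where "f p = snd p \<lhd> rip (fst p) y" for p
  have f: "f p \<in> carrier" if "p \<in> set ps" for p using mem[OF that] by (simp add: f_def)
  have one: "(\<Sum>p\<leftarrow>ps. lip (snd p) (fst p)) = 1"
  proof -
    have "(\<Sum>p\<leftarrow>ps. lip (snd p) (fst p)) = star (\<Sum>p\<leftarrow>ps. lip (fst p) (snd p))"
      using mem by (simp add: star_sum_list lip_star cong: map_cong)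
    then show ?thesis by (simp add: ps(2))
  qed
  have y_eq: "(\<Sum>p\<leftarrow>ps. f p) = y"
  proof -
    have "(\<Sum>p\<leftarrow>ps. f p) = (\<Sum>p\<leftarrow>ps. lip (snd p) (fst p) \<rhd> y)"
      using mem y by (simp add: f_def imprimitivity cong: map_cong)
    also have "\<dots> = y" using y by (simp add: one lact_one flip: lact_sum_list_left)
    finally show ?thesis .
  qed
  have on_X: "(\<Sum>v\<leftarrow>vs. E\<^sub>X (x \<lhd> d \<lhd> v) \<lhd> star v) = x \<lhd> d" if "x \<in> X" for d x
  proof -
    have "(\<Sum>v\<leftarrow>vs. E\<^sub>X (x \<lhd> d \<lhd> v) \<lhd> star v) = x \<lhd> (\<Sum>v\<leftarrow>vs. E\<^sub>B (d * v) * star v)"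
      using that X_subset[OF that] by (simp add: ract_sum_list_right E\<^sub>X_ract flip: ract_mult)
    then show ?thesis by (simp add: R.basis_right)
  qed
  have "(\<Sum>v\<leftarrow>vs. E\<^sub>X ((\<Sum>p\<leftarrow>ps. f p) \<lhd> v) \<lhd> star v) = (\<Sum>v\<leftarrow>vs. \<Sum>p\<leftarrow>ps. E\<^sub>X (f p \<lhd> v) \<lhd> star v)"
    using f by (simp add: ract_sum_list E\<^sub>X_sum_list)
  also have "\<dots> = (\<Sum>p\<leftarrow>ps. f p)"
    using mem by (subst sum_list_swap) (simp add: f_def on_X cong: map_cong)
  finally show ?thesis unfolding y_eq .
qed

text \<open>Both sides are \<open>\<Sum> u\<cdot>E\<^sub>X(u\<^sup>*\<cdot>y\<cdot>v)\<cdot>v\<^sup>*\<close>: summing over \<open>v\<close> first leaves \<open>\<Sum> u u\<^sup>*\<cdot>y\<close>, and summing over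
\<open>u\<close> first leaves \<open>\<Sum> y\<cdot>v v\<^sup>*\<close>.\<close>

lemma index_intertwined:
  assumes y: "y \<in> carrier"
  shows "L.index \<rhd> y = y \<lhd> R.index"
proof -
  have "L.index \<rhd> y = (\<Sum>u\<leftarrow>us. u \<rhd> (\<Sum>v\<leftarrow>vs. E\<^sub>X ((star u \<rhd> y) \<lhd> v) \<lhd> star v))"
    using y by (simp add: L.index_def lact_sum_list_left lact_mult right_expansion)
  also have "\<dots> = (\<Sum>u\<leftarrow>us. \<Sum>v\<leftarrow>vs. (u \<rhd> E\<^sub>X (star u \<rhd> y \<lhd> v)) \<lhd> star v)"
    using y by (simp add: lact_sum_list act_assoc)
  also have "\<dots> = (\<Sum>v\<leftarrow>vs. (\<Sum>u\<leftarrow>us. u \<rhd> E\<^sub>X (star u \<rhd> y \<lhd> v)) \<lhd> star v)"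
    using y by (subst sum_list_swap) (simp add: ract_sum_list)
  also have "\<dots> = y \<lhd> R.index"
    using y by (simp add: left_expansion R.index_def ract_sum_list_right ract_mult)
  finally show ?thesis .
qed

lemma index_inv_intertwined:
  assumes y: "y \<in> carrier"
  shows "L.index_inv \<rhd> y = y \<lhd> R.index_inv"
proof -
  have "L.index_inv \<rhd> y = L.index_inv \<rhd> (y \<lhd> R.index) \<lhd> R.index_inv"
    using y by (simp add: R.index_inv_right ract_one flip: ract_mult)
  also have "\<dots> = L.index_inv \<rhd> (L.index \<rhd> y) \<lhd> R.index_inv" using y by (simp add: index_intertwined)
  also have "\<dots> = y \<lhd> R.index_inv"
    using y by (simp add: act_assoc L.index_inv_left lact_one flip: lact_mult)
  finally show ?thesis .
qed

end


section \<open>The bimodule over the basic constructions\<close>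

lemma clinear_on_compose:
  "clinear_on S f \<Longrightarrow> clinear_on T g \<Longrightarrow> (\<And>x. x \<in> S \<Longrightarrow> f x \<in> T) \<Longrightarrow> clinear_on S (\<lambda>x. g (f x))"
  by (simp add: clinear_on_def)

lemma clinear_on_sum_of:
  "(\<And>i. i \<in> set is \<Longrightarrow> clinear_on S (f i)) \<Longrightarrow> clinear_on S (\<lambda>x. \<Sum>i\<leftarrow>is. f i x)"
  by (induction "is") (simp_all add: clinear_on_def scaleC_add_right add.assoc add.left_commute)

locale tensor_product =
  fixes M :: "('l::complex_vector, 'm::complex_vector, 'x::complex_vector) bimodule"
    and N :: "('m, 'r::complex_vector, 'y::complex_vector) bimodule"
    and T :: "('l, 'r, 'z::complex_vector) bimodule" and t :: "'x \<Rightarrow> 'y \<Rightarrow> 'z"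
  assumes tensor: "is_tensor_product M N T t"
begin

lemma algebras: "lalg T = lalg M" "ralg T = ralg N"
  using tensor by (simp_all add: is_tensor_product_def)

sublocale equiv_bimodule T
  by unfold_locales (use tensor in \<open>simp add: is_tensor_product_def\<close>)

lemma tensor_in: "m \<in> bcar M \<Longrightarrow> n \<in> bcar N \<Longrightarrow> t m n \<in> bcar T"
  and tensor_lact: "m \<in> bcar M \<Longrightarrow> n \<in> bcar N \<Longrightarrow> a \<in> acar (lalg M) \<Longrightarrow>
    lact T a (t m n) = t (lact M a m) n"
  and tensor_ract: "m \<in> bcar M \<Longrightarrow> n \<in> bcar N \<Longrightarrow> d \<in> acar (ralg N) \<Longrightarrow>
    ract T (t m n) d = t m (ract N n d)"
  and tensor_linner: "m \<in> bcar M \<Longrightarrow> n \<in> bcar N \<Longrightarrow> m' \<in> bcar M \<Longrightarrow> n' \<in> bcar N \<Longrightarrow>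
    linner T (t m n) (t m' n') = linner M (ract M m (linner N n n')) m'"
  and tensor_rinner: "m \<in> bcar M \<Longrightarrow> n \<in> bcar N \<Longrightarrow> m' \<in> bcar M \<Longrightarrow> n' \<in> bcar N \<Longrightarrow>
    rinner T (t m n) (t m' n') = rinner N n (lact N (rinner M m m') n')"
  using tensor by (simp_all add: is_tensor_product_def)

end

lemma basic_construction_simps [simp]:
  "amult (basic_construction E) = (\<circ>)" "aone (basic_construction E) = id"
  "astar (basic_construction E) = adjoint_op E"
  by (simp_all add: basic_construction_def)

locale basic_construction_bimodule =
  expected_inclusion A E\<^sub>A us B E\<^sub>B vs Y X E\<^sub>X +
  T1: tensor_product "basic_bimodule A E\<^sub>A" "sub_bimodule Y A B X" Z t1 +
  T2: tensor_product Z "dual_bimodule (basic_bimodule B E\<^sub>B)" Y1 t2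
  for A :: "'c::cstar_algebra set" and E\<^sub>A us
    and B :: "'d::cstar_algebra set" and E\<^sub>B vs
    and Y :: "('c, 'd, 'y::complex_vector) bimodule" and X E\<^sub>X
    and Z :: "('c \<Rightarrow> 'c, 'd, 'z::complex_vector) bimodule" and t1
    and Y1 :: "('c \<Rightarrow> 'c, 'd \<Rightarrow> 'd, 'w::complex_vector) bimodule" and t2
begin

abbreviation carrier1 where "carrier1 \<equiv> bcar Y1"

text \<open>The elementary tensor of \<open>c\<close>, \<open>x\<close> and \<open>tilde d\<close>. It is conjugate linear in \<open>d\<close>, and \<open>D\<^sub>1\<close> acts on \<open>d\<close>
through adjoints.\<close>

definition elem :: "'c \<Rightarrow> 'y \<Rightarrow> 'd \<Rightarrow> 'w" where
  "elem c x d = t2 (t1 c x) (tilde d)"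

definition embed :: "'y \<Rightarrow> 'w" where
  "embed = upward_embedding Y E\<^sub>X elem us vs"

text \<open>This is \<open>E\<^sup>Y\<close> with values in \<open>Y\<close>, before composition with the embedding.\<close>

definition F\<^sub>Y :: "'w \<Rightarrow> 'y" where
  "F\<^sub>Y = dual_bimodule_expectation E\<^sub>A Y X Y1 elem"

lemma lalg_Z: "lalg Z = basic_construction E\<^sub>A"
  and lalg_Y1 [simp]: "lalg Y1 = basic_construction E\<^sub>A"
  and ralg_Y1 [simp]: "ralg Y1 = basic_construction E\<^sub>B"
  using T1.algebras T2.algebras by (simp_all add: basic_bimodule_def sub_bimodule_def dual_bimodule_def)

lemma t1_in: "x \<in> X \<Longrightarrow> t1 c x \<in> bcar Z"
  using T1.tensor_in by (simp add: basic_bimodule_def sub_bimodule_def)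

lemma elem_in: "x \<in> X \<Longrightarrow> elem c x d \<in> carrier1"
  using T2.tensor_in[OF t1_in, of x "tilde d" c]
  by (simp add: elem_def basic_bimodule_def dual_bimodule_def)

lemma elem_lact: "T \<in> L.C1 \<Longrightarrow> x \<in> X \<Longrightarrow> lact Y1 T (elem c x d) = elem (T c) x d"
  using T2.tensor_lact[OF t1_in, of x "tilde d" T c] T1.tensor_lact[of c x T]
  by (simp add: elem_def basic_bimodule_def dual_bimodule_def sub_bimodule_def lalg_Z)

lemma elem_ract: "T \<in> R.C1 \<Longrightarrow> x \<in> X \<Longrightarrow> ract Y1 (elem c x d) T = elem c x (adjoint_op E\<^sub>B T d)"
  using T2.tensor_ract[OF t1_in, of x "tilde d" T c]
  by (simp add: elem_def basic_bimodule_def dual_bimodule_def)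

lemma elem_linner:
  assumes "x \<in> X" "x' \<in> X"
  shows "linner Y1 (elem c x d) (elem c' x' d') =
    jones E\<^sub>A (c * lip (x \<lhd> E\<^sub>B (star d * d')) x') (star c')"
proof -
  have b: "E\<^sub>B (star d * d') \<in> B" by (rule R.E_in)
  have "linner Y1 (elem c x d) (elem c' x' d') = linner Z (ract Z (t1 c x) (E\<^sub>B (star d * d'))) (t1 c' x')"
    using T2.tensor_linner[OF t1_in[OF assms(1)] _ t1_in[OF assms(2)], of "tilde d" "tilde d'"]
    by (simp add: elem_def basic_bimodule_def dual_bimodule_def)
  also have "ract Z (t1 c x) (E\<^sub>B (star d * d')) = t1 c (x \<lhd> E\<^sub>B (star d * d'))"
    using T1.tensor_ract[of c x "E\<^sub>B (star d * d')"] assms b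
    by (simp add: basic_bimodule_def sub_bimodule_def)
  also have "linner Z (t1 c (x \<lhd> E\<^sub>B (star d * d'))) (t1 c' x') =
      jones E\<^sub>A (c * lip (x \<lhd> E\<^sub>B (star d * d')) x') (star c')"
    using T1.tensor_linner[of c "x \<lhd> E\<^sub>B (star d * d')" c' x'] assms ract_X[OF b]
    by (simp add: basic_bimodule_def sub_bimodule_def)
  finally show ?thesis .
qed

lemma elem_rinner:
  assumes "x \<in> X" "x' \<in> X"
  shows "rinner Y1 (elem c x d) (elem c' x' d') =
    jones E\<^sub>B d (rip x (E\<^sub>A (star c * c') \<rhd> x') * star d')"
proof -
  have a: "E\<^sub>A (star c * c') \<in> A" by (rule L.E_in)
  have "rinner Z (t1 c x) (t1 c' x') = rip x (E\<^sub>A (star c * c') \<rhd> x')"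
    using T1.tensor_rinner[of c x c' x'] assms
    by (simp add: basic_bimodule_def sub_bimodule_def)
  then show ?thesis
    using T2.tensor_rinner[OF t1_in[OF assms(1)] _ t1_in[OF assms(2)], of "tilde d" "tilde d'"]
    by (simp add: elem_def basic_bimodule_def dual_bimodule_def star_mult star_star)
qed

lemma jones_sum_list_left: "(\<Sum>i\<leftarrow>is. jones E\<^sub>A (a i) b) = jones E\<^sub>A (\<Sum>i\<leftarrow>is. a i) b"
  by (rule ext) (simp add: sum_list_apply jones_apply sum_list_mult_right)

lemma jones_sum_list_right: "(\<Sum>i\<leftarrow>is. jones E\<^sub>B a (b i)) = jones E\<^sub>B a (\<Sum>i\<leftarrow>is. b i)"
  by (rule ext) (simp add: sum_list_apply jones_apply sum_list_mult_left R.E_sum_list flip: sum_list_mult_right)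

subsection \<open>Reconstruction from the elementary tensors\<close>

text \<open>For a frame of pairs \<open>(y, x)\<close>, applying \<open>E\<^sub>B\<close> replaces \<open>y\<close> by \<open>E\<^sub>X y \<in> X\<close>. Then the right inner products
of \<open>1 \<otimes> E\<^sub>X y \<otimes> v~\<close> and \<open>1 \<otimes> x \<otimes> v~\<close> sum to \<open>\<Sum> v e\<^sub>B v\<^sup>* = 1\<close>. Letting this unit act on
\<open>\<eta>\<close> and applying the imprimitivity relation writes \<open>\<eta>\<close> as a finite sum of elementary tensors whose
coefficients are inner products of \<open>\<eta>\<close>.\<close>

lemma reconstruction:
  assumes "set ps \<subseteq> carrier \<times> X" "(\<Sum>p\<leftarrow>ps. rip (fst p) (snd p)) = 1" and \<eta>: "\<eta> \<in> carrier1"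
  shows "\<eta> = (\<Sum>p\<leftarrow>ps. \<Sum>v\<leftarrow>vs. elem (linner Y1 \<eta> (elem 1 (E\<^sub>X (fst p)) v) 1) (snd p) v)"
proof -
  note mem = frame_mem[OF assms(1)]
  let ?s = "\<lambda>p v. elem 1 (E\<^sub>X (fst p)) v"
  let ?s' = "\<lambda>p v. elem 1 (snd p) v"
  have in1: "?s p v \<in> carrier1" "?s' p v \<in> carrier1" if "p \<in> set ps" for p v
    using mem[OF that] by (auto intro!: elem_in E\<^sub>X_in)
  have "1 = E\<^sub>B (\<Sum>p\<leftarrow>ps. rip (fst p) (snd p))"
    using assms(2) by (simp add: R.E_id R.one_in)
  also have "\<dots> = (\<Sum>p\<leftarrow>ps. rip (E\<^sub>X (fst p)) (snd p))"
    using mem by (simp add: R.E_sum_list E\<^sub>B_rip cong: map_cong)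
  finally have one: "(\<Sum>p\<leftarrow>ps. rip (E\<^sub>X (fst p)) (snd p)) = 1" ..
  have "(\<Sum>p\<leftarrow>ps. \<Sum>v\<leftarrow>vs. rinner Y1 (?s p v) (?s' p v)) =
      (\<Sum>v\<leftarrow>vs. \<Sum>p\<leftarrow>ps. jones E\<^sub>B v (rip (E\<^sub>X (fst p)) (snd p) * star v))"
    using mem by (subst sum_list_swap)
      (simp add: elem_rinner E\<^sub>X_in L.E_id L.one_in lact_one cong: map_cong)
  also have "\<dots> = (\<Sum>v\<leftarrow>vs. jones E\<^sub>B v (star v))"
    by (simp add: jones_sum_list_right sum_list_mult_right one)
  also have "\<dots> = id"
    by (rule ext) (simp add: sum_list_apply jones_apply R.basis_left)
  finally have id: "(\<Sum>p\<leftarrow>ps. \<Sum>v\<leftarrow>vs. rinner Y1 (?s p v) (?s' p v)) = id" .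
  have sum_in: "(\<Sum>v\<leftarrow>vs. rinner Y1 (?s p v) (?s' p v)) \<in> R.C1" if "p \<in> set ps" for p
    using T2.rinner_in in1[OF that] by (intro csubspace_sum_list R.C1_subspace) simp
  have lin: "clinear_on R.C1 (ract Y1 \<eta>)" using T2.ract_linear_alg[OF \<eta>] by simp
  have "\<eta> = ract Y1 \<eta> (\<Sum>p\<leftarrow>ps. \<Sum>v\<leftarrow>vs. rinner Y1 (?s p v) (?s' p v))"
    using T2.ract_one[OF \<eta>] by (simp add: id)
  also have "\<dots> = (\<Sum>p\<leftarrow>ps. ract Y1 \<eta> (\<Sum>v\<leftarrow>vs. rinner Y1 (?s p v) (?s' p v)))"
    by (rule clinear_on_sum_list[OF R.C1_subspace lin sum_in])
  also have "\<dots> = (\<Sum>p\<leftarrow>ps. \<Sum>v\<leftarrow>vs. elem (linner Y1 \<eta> (?s p v) 1) (snd p) v)"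
  proof (intro arg_cong[of _ _ sum_list] map_cong refl)
    fix p assume p: "p \<in> set ps"
    have "ract Y1 \<eta> (\<Sum>v\<leftarrow>vs. rinner Y1 (?s p v) (?s' p v)) = (\<Sum>v\<leftarrow>vs. ract Y1 \<eta> (rinner Y1 (?s p v) (?s' p v)))"
      using T2.rinner_in in1[OF p] by (intro clinear_on_sum_list[OF R.C1_subspace lin]) simp
    also have "\<dots> = (\<Sum>v\<leftarrow>vs. elem (linner Y1 \<eta> (?s p v) 1) (snd p) v)"
    proof (intro arg_cong[of _ _ sum_list] map_cong refl)
      fix v
      have "linner Y1 \<eta> (?s p v) \<in> L.C1" using T2.linner_in[OF \<eta> in1(1)[OF p]] by simp
      then show "ract Y1 \<eta> (rinner Y1 (?s p v) (?s' p v)) = elem (linner Y1 \<eta> (?s p v) 1) (snd p) v"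
        unfolding T2.imprimitivity[OF \<eta> in1(1)[OF p] in1(2)[OF p], symmetric]
        by (rule elem_lact[OF _ mem(2)[OF p]])
    qed
    finally show "ract Y1 \<eta> (\<Sum>v\<leftarrow>vs. rinner Y1 (?s p v) (?s' p v)) = \<dots>" .
  qed
  finally show ?thesis .
qed

lemma carrier1_eq: "carrier1 = cspan {elem c x d | c x d. x \<in> X}"
proof
  show "cspan {elem c x d | c x d. x \<in> X} \<subseteq> carrier1"
    using elem_in by (intro complex_vector.span_minimal T2.carrier_subspace) blast
  obtain ps where ps: "set ps \<subseteq> carrier \<times> X" "(\<Sum>p\<leftarrow>ps. rip (fst p) (snd p)) = 1"
    using right_frame by blast
  show "carrier1 \<subseteq> cspan {elem c x d | c x d. x \<in> X}"
  proof
    fix \<eta> assume "\<eta> \<in> carrier1"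
    note eq = reconstruction[OF ps this]
    have "elem c (snd p) d \<in> cspan {elem c x d | c x d. x \<in> X}" if "p \<in> set ps" for p c d
      by (rule complex_vector.span_base) (use frame_mem(2)[OF ps(1) that] in blast)
    then show "\<eta> \<in> cspan {elem c x d | c x d. x \<in> X}"
      by (subst eq) (intro csubspace_sum_list complex_vector.subspace_span)
  qed
qed

text \<open>The reason why \<open>E\<^sup>Y\<close> is well determined by its values on elementary tensors.\<close>

lemma linear_eq_on_elem:
  assumes "clinear_on carrier1 f" "clinear_on carrier1 g"
    and "\<And>c x d. x \<in> X \<Longrightarrow> f (elem c x d) = g (elem c x d)" and "\<xi> \<in> carrier1"
  shows "f \<xi> = g \<xi>"
  by (rule clinear_on_span_eq[OF assms(1,2)[unfolded carrier1_eq] _ assms(4)[unfolded carrier1_eq]])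
    (use assms(3) in blast)

lemma eq_by_linner:
  assumes "\<eta> \<in> carrier1" "\<eta>' \<in> carrier1"
    and "\<And>c x d. x \<in> X \<Longrightarrow> linner Y1 \<eta> (elem c x d) = linner Y1 \<eta>' (elem c x d)"
  shows "\<eta> = \<eta>'"
proof -
  obtain ps where ps: "set ps \<subseteq> carrier \<times> X" "(\<Sum>p\<leftarrow>ps. rip (fst p) (snd p)) = 1"
    using right_frame by blast
  have "E\<^sub>X (fst p) \<in> X" if "p \<in> set ps" for p
    by (rule E\<^sub>X_in[OF frame_mem(1)[OF ps(1) that]])
  then have "(\<Sum>p\<leftarrow>ps. \<Sum>v\<leftarrow>vs. elem (linner Y1 \<eta> (elem 1 (E\<^sub>X (fst p)) v) 1) (snd p) v) =
      (\<Sum>p\<leftarrow>ps. \<Sum>v\<leftarrow>vs. elem (linner Y1 \<eta>' (elem 1 (E\<^sub>X (fst p)) v) 1) (snd p) v)"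
    by (simp add: assms(3) cong: map_cong)
  then show ?thesis using reconstruction[OF ps assms(1)] reconstruction[OF ps assms(2)] by simp
qed

subsection \<open>The embedding\<close>

lemma embed_eq: "embed y = (\<Sum>u\<leftarrow>us. \<Sum>v\<leftarrow>vs. elem u (E\<^sub>X ((star u \<rhd> y) \<lhd> v)) v)"
  by (simp add: embed_def upward_embedding_def)

lemma summand_in: "y \<in> carrier \<Longrightarrow> elem u (E\<^sub>X ((star u \<rhd> y) \<lhd> v)) v \<in> carrier1"
  by (simp add: elem_in E\<^sub>X_in)

lemma inner_sum_in: "y \<in> carrier \<Longrightarrow> (\<Sum>v\<leftarrow>vs. elem u (E\<^sub>X ((star u \<rhd> y) \<lhd> v)) v) \<in> carrier1"
  by (intro csubspace_sum_list T2.carrier_subspace summand_in)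

lemma embed_in: "y \<in> carrier \<Longrightarrow> embed y \<in> carrier1"
  unfolding embed_eq by (intro csubspace_sum_list T2.carrier_subspace inner_sum_in)

lemma linear_embed:
  assumes "clinear_on carrier1 f" "y \<in> carrier"
  shows "f (embed y) = (\<Sum>u\<leftarrow>us. \<Sum>v\<leftarrow>vs. f (elem u (E\<^sub>X ((star u \<rhd> y) \<lhd> v)) v))"
  unfolding embed_eq
  by (simp add: clinear_on_sum_list[OF T2.carrier_subspace assms(1)] inner_sum_in summand_in assms(2))

lemma E\<^sub>X_right_expansion:
  assumes "y \<in> carrier"
  shows "(\<Sum>v\<leftarrow>vs. E\<^sub>X (y \<lhd> v) \<lhd> E\<^sub>B (star v * d)) = E\<^sub>X (y \<lhd> d)"
proof -
  have "(\<Sum>v\<leftarrow>vs. E\<^sub>X (y \<lhd> v) \<lhd> E\<^sub>B (star v * d)) = E\<^sub>X (\<Sum>v\<leftarrow>vs. y \<lhd> (v * E\<^sub>B (star v * d)))"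
    using assms by (simp add: E\<^sub>X_sum_list ract_mult E\<^sub>X_right R.E_in)
  then show ?thesis using assms by (simp add: R.basis_left flip: ract_sum_list_right)
qed

lemma E\<^sub>X_left_expansion:
  assumes "y \<in> carrier"
  shows "(\<Sum>u\<leftarrow>us. E\<^sub>A (c * u) \<rhd> E\<^sub>X (star u \<rhd> y)) = E\<^sub>X (c \<rhd> y)"
proof -
  have "(\<Sum>u\<leftarrow>us. E\<^sub>A (c * u) \<rhd> E\<^sub>X (star u \<rhd> y)) = E\<^sub>X (\<Sum>u\<leftarrow>us. (E\<^sub>A (c * u) * star u) \<rhd> y)"
    using assms by (simp add: E\<^sub>X_sum_list lact_mult E\<^sub>X_left L.E_in)
  then show ?thesis using assms by (simp add: L.basis_right flip: lact_sum_list_left)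
qed

text \<open>The sum over \<open>v\<close> replaces \<open>E\<^sub>X(u\<^sup>*\<cdot>y\<cdot>v)\<cdot>E\<^sub>B(v\<^sup>*d)\<close> by \<open>E\<^sub>X(u\<^sup>*\<cdot>y\<cdot>d)\<close>, and then the sum over \<open>u\<close>
replaces \<open>u\<cdot>E\<^sub>X(u\<^sup>*\<cdot>(y\<cdot>d))\<close> by \<open>y\<cdot>d\<close>.\<close>

lemma embed_linner_elem:
  assumes y: "y \<in> carrier" and x: "x \<in> X"
  shows "linner Y1 (embed y) (elem c x d) = jones E\<^sub>A (lip (y \<lhd> d) x) (star c)"
proof -
  note xc = X_subset[OF x]
  have inner: "(\<Sum>v\<leftarrow>vs. u * lip (E\<^sub>X ((star u \<rhd> y) \<lhd> v) \<lhd> E\<^sub>B (star v * d)) x) =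
      lip (u \<rhd> E\<^sub>X (star u \<rhd> (y \<lhd> d))) x" for u
  proof -
    have "(\<Sum>v\<leftarrow>vs. u * lip (E\<^sub>X ((star u \<rhd> y) \<lhd> v) \<lhd> E\<^sub>B (star v * d)) x) =
        u * lip (\<Sum>v\<leftarrow>vs. E\<^sub>X ((star u \<rhd> y) \<lhd> v) \<lhd> E\<^sub>B (star v * d)) x"
      using y xc by (simp add: lip_sum_list sum_list_mult_left)
    then show ?thesis using y xc E\<^sub>X_right_expansion[of "star u \<rhd> y" d]
      by (simp add: lip_lact act_assoc)
  qed
  have "linner Y1 (embed y) (elem c x d) =
      (\<Sum>u\<leftarrow>us. \<Sum>v\<leftarrow>vs. linner Y1 (elem u (E\<^sub>X ((star u \<rhd> y) \<lhd> v)) v) (elem c x d))"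
    by (rule linear_embed[OF T2.linner_linear[OF elem_in[OF x]] y])
  also have "\<dots> = jones E\<^sub>A (\<Sum>u\<leftarrow>us. lip (u \<rhd> E\<^sub>X (star u \<rhd> (y \<lhd> d))) x) (star c)"
    using x y by (simp add: elem_linner E\<^sub>X_in jones_sum_list_left inner)
  also have "(\<Sum>u\<leftarrow>us. lip (u \<rhd> E\<^sub>X (star u \<rhd> (y \<lhd> d))) x) = lip (y \<lhd> d) x"
    using y xc by (simp add: left_expansion flip: lip_sum_list)
  finally show ?thesis .
qed

lemma elem_linner_embed:
  assumes y: "y \<in> carrier" and x: "x \<in> X"
  shows "linner Y1 (elem c x d) (embed y) = jones E\<^sub>A c (lip x (y \<lhd> d))"
  using T2.linner_star[OF embed_in[OF y] elem_in[OF x], of c d] y X_subset[OF x]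
  by (simp add: embed_linner_elem[OF y x] L.adjoint_jones star_star lip_star)

text \<open>The same collapse in the other order: the sum over \<open>u\<close> gives \<open>E\<^sub>X(c\<^sup>*\<cdot>y\<cdot>v)\<close>, and then the sum over
\<open>v\<close> gives \<open>c\<^sup>*\<cdot>y\<close>.\<close>

lemma elem_rinner_embed:
  assumes y: "y \<in> carrier" and x: "x \<in> X"
  shows "rinner Y1 (elem c x d) (embed y) = jones E\<^sub>B d (rip x (star c \<rhd> y))"
proof -
  note xc = X_subset[OF x]
  have inner: "(\<Sum>u\<leftarrow>us. rip x (E\<^sub>A (star c * u) \<rhd> E\<^sub>X ((star u \<rhd> y) \<lhd> v)) * star v) =
      rip x (E\<^sub>X ((star c \<rhd> y) \<lhd> v) \<lhd> star v)" for v
  proof -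
    have "(\<Sum>u\<leftarrow>us. rip x (E\<^sub>A (star c * u) \<rhd> E\<^sub>X ((star u \<rhd> y) \<lhd> v)) * star v) =
        rip x (\<Sum>u\<leftarrow>us. E\<^sub>A (star c * u) \<rhd> E\<^sub>X (star u \<rhd> (y \<lhd> v))) * star v"
      using y xc by (simp add: rip_sum_list sum_list_mult_right act_assoc)
    then show ?thesis using y xc by (simp add: E\<^sub>X_left_expansion rip_ract act_assoc)
  qed
  have "rinner Y1 (elem c x d) (embed y) =
      (\<Sum>v\<leftarrow>vs. \<Sum>u\<leftarrow>us. rinner Y1 (elem c x d) (elem u (E\<^sub>X ((star u \<rhd> y) \<lhd> v)) v))"
    by (subst sum_list_swap) (rule linear_embed[OF T2.rinner_linear[OF elem_in[OF x]] y])
  also have "\<dots> = jones E\<^sub>B d (\<Sum>v\<leftarrow>vs. rip x (E\<^sub>X ((star c \<rhd> y) \<lhd> v) \<lhd> star v))"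
    using x y by (simp add: elem_rinner E\<^sub>X_in jones_sum_list_right inner)
  also have "(\<Sum>v\<leftarrow>vs. rip x (E\<^sub>X ((star c \<rhd> y) \<lhd> v) \<lhd> star v)) = rip x (star c \<rhd> y)"
    using y xc by (simp add: right_expansion flip: rip_sum_list)
  finally show ?thesis .
qed

lemma embed_rinner_elem:
  assumes y: "y \<in> carrier" and x: "x \<in> X"
  shows "rinner Y1 (embed y) (elem c x d) = jones E\<^sub>B (rip (star c \<rhd> y) x) (star d)"
  using T2.rinner_star[OF elem_in[OF x] embed_in[OF y], of c d] y X_subset[OF x]
  by (simp add: elem_rinner_embed[OF y x] R.adjoint_jones rip_star)

text \<open>Only one of the two copies of the embedding has to be expanded, since \<open>elem_linner_embed\<close> already
handles the other.\<close>

lemma embed_linner: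
  assumes y: "y \<in> carrier" and y': "y' \<in> carrier"
  shows "linner Y1 (embed y) (embed y') = lmult (lip y y')"
proof -
  have "linner Y1 (embed y) (embed y') =
      (\<Sum>u\<leftarrow>us. \<Sum>v\<leftarrow>vs. linner Y1 (elem u (E\<^sub>X ((star u \<rhd> y) \<lhd> v)) v) (embed y'))"
    by (rule linear_embed[OF T2.linner_linear[OF embed_in[OF y']] y])
  also have "\<dots> = (\<Sum>u\<leftarrow>us. jones E\<^sub>A u (star u * lip y y'))"
  proof (rule ext)
    fix z
    have "(\<Sum>v\<leftarrow>vs. lip (E\<^sub>X ((star u \<rhd> y) \<lhd> v)) (y' \<lhd> v)) = star u * lip y y'" for u
    proof -
      have "(\<Sum>v\<leftarrow>vs. lip (E\<^sub>X ((star u \<rhd> y) \<lhd> v)) (y' \<lhd> v)) =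
          (\<Sum>v\<leftarrow>vs. lip (E\<^sub>X ((star u \<rhd> y) \<lhd> v) \<lhd> star v) y')"
        using y y' by (simp add: lip_ract star_star)
      also have "\<dots> = lip (\<Sum>v\<leftarrow>vs. E\<^sub>X ((star u \<rhd> y) \<lhd> v) \<lhd> star v) y'"
        using y y' by (simp add: lip_sum_list)
      finally show ?thesis using y y' by (simp add: right_expansion lip_lact)
    qed
    then have "(\<Sum>v\<leftarrow>vs. u * E\<^sub>A (lip (E\<^sub>X ((star u \<rhd> y) \<lhd> v)) (y' \<lhd> v) * z)) = u * E\<^sub>A (star u * lip y y' * z)" for u
      by (simp add: sum_list_mult_left sum_list_mult_right flip: L.E_sum_list)
    then show "(\<Sum>u\<leftarrow>us. \<Sum>v\<leftarrow>vs. linner Y1 (elem u (E\<^sub>X ((star u \<rhd> y) \<lhd> v)) v) (embed y')) z =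
        (\<Sum>u\<leftarrow>us. jones E\<^sub>A u (star u * lip y y')) z"
      using y y' by (simp add: elem_linner_embed E\<^sub>X_in sum_list_apply jones_apply)
  qed
  also have "\<dots> = lmult (lip y y')"
    by (rule ext) (simp add: sum_list_apply jones_apply lmult_def mult.assoc L.basis_left)
  finally show ?thesis .
qed

lemma embed_rinner:
  assumes y: "y \<in> carrier" and y': "y' \<in> carrier"
  shows "rinner Y1 (embed y) (embed y') = lmult (rip y y')"
proof -
  have inner: "(\<Sum>u\<leftarrow>us. rip (star u \<rhd> y) (E\<^sub>X ((star u \<rhd> y') \<lhd> v))) = rip y y' * v" for v
  proof -
    have "(\<Sum>u\<leftarrow>us. rip (star u \<rhd> y) (E\<^sub>X ((star u \<rhd> y') \<lhd> v))) =
        rip y (\<Sum>u\<leftarrow>us. u \<rhd> E\<^sub>X (star u \<rhd> (y' \<lhd> v)))"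
      using y y' by (simp add: rip_lact star_star rip_sum_list act_assoc)
    then show ?thesis using y y' by (simp add: left_expansion rip_ract)
  qed
  have "rinner Y1 (embed y) (embed y') =
      (\<Sum>v\<leftarrow>vs. \<Sum>u\<leftarrow>us. rinner Y1 (embed y) (elem u (E\<^sub>X ((star u \<rhd> y') \<lhd> v)) v))"
    by (subst sum_list_swap) (rule linear_embed[OF T2.rinner_linear[OF embed_in[OF y]] y'])
  also have "\<dots> = (\<Sum>v\<leftarrow>vs. jones E\<^sub>B (rip y y' * v) (star v))"
    using y y' by (intro ext)
      (simp add: embed_rinner_elem E\<^sub>X_in sum_list_apply jones_apply sum_list_mult_right inner)
  also have "\<dots> = lmult (rip y y')"
    by (rule R.lmult_eq_sum[symmetric])
  finally show ?thesis .
qed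

text \<open>Linearity and covariance of the embedding are read off from its inner products with elementary tensors,
so that the defining double sum need not be rearranged.\<close>

lemma embed_linear: "clinear_on carrier embed"
proof -
  have lin: "linner Y1 (\<eta> + \<eta>') (elem c x d) = linner Y1 \<eta> (elem c x d) + linner Y1 \<eta>' (elem c x d)"
    "linner Y1 (r *\<^sub>C \<eta>) (elem c x d) = r *\<^sub>C linner Y1 \<eta> (elem c x d)"
    if "\<eta> \<in> carrier1" "\<eta>' \<in> carrier1" "x \<in> X" for \<eta> \<eta>' r c x d
    using T2.linner_linear[OF elem_in[OF that(3)], of c d] that by (simp_all add: clinear_on_def)
  have ylin: "lip ((y + y') \<lhd> d) x = lip (y \<lhd> d) x + lip (y' \<lhd> d) x"
    "lip ((r *\<^sub>C y) \<lhd> d) x = r *\<^sub>C lip (y \<lhd> d) x"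
    if "y \<in> carrier" "y' \<in> carrier" "x \<in> carrier" for y y' r x d
    using that Y.linner_linear[OF that(3)] Y.ract_linear[of d] ract_in by (simp_all add: clinear_on_def)
  have "embed (y + y') = embed y + embed y'" if y: "y \<in> carrier" and y': "y' \<in> carrier" for y y'
  proof (rule eq_by_linner)
    have yy': "y + y' \<in> carrier" using Y.carrier_subspace y y' by (rule complex_vector.subspace_add)
    then show "embed (y + y') \<in> carrier1" by (rule embed_in)
    show "embed y + embed y' \<in> carrier1"
      by (intro complex_vector.subspace_add T2.carrier_subspace embed_in y y')
    show "linner Y1 (embed (y + y')) (elem c x d) = linner Y1 (embed y + embed y') (elem c x d)"
      if "x \<in> X" for c x d
      using that y y' yy' X_subset[OF that]
      by (intro ext) (simp add: lin embed_in embed_linner_elem jones_apply ylin distrib_right)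
  qed
  moreover have "embed (r *\<^sub>C y) = r *\<^sub>C embed y" if y: "y \<in> carrier" for r y
  proof (rule eq_by_linner)
    have ry: "r *\<^sub>C y \<in> carrier" using Y.carrier_subspace y by (rule complex_vector.subspace_scale)
    then show "embed (r *\<^sub>C y) \<in> carrier1" by (rule embed_in)
    show "r *\<^sub>C embed y \<in> carrier1"
      by (intro complex_vector.subspace_scale T2.carrier_subspace embed_in y)
    show "linner Y1 (embed (r *\<^sub>C y)) (elem c x d) = linner Y1 (r *\<^sub>C embed y) (elem c x d)"
      if "x \<in> X" for c x d
      using that y ry X_subset[OF that] lin(2)[OF embed_in[OF y] embed_in[OF y] that]
        ylin(2)[OF y y X_subset[OF that]]
      by (intro ext) (simp add: embed_linner_elem jones_apply scaleC_fun_def scaleC_mult_left)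
  qed
  ultimately show ?thesis by (simp add: clinear_on_def)
qed

lemma embed_lact:
  assumes y: "y \<in> carrier"
  shows "embed (c \<rhd> y) = lact Y1 (lmult c) (embed y)"
proof (rule eq_by_linner)
  show "lact Y1 (lmult c) (embed y) \<in> carrier1"
    using T2.lact_in embed_in[OF y] L.lmult_in by simp
  show "linner Y1 (embed (c \<rhd> y)) (elem c' x d) = linner Y1 (lact Y1 (lmult c) (embed y)) (elem c' x d)"
    if x: "x \<in> X" for c' x d
  proof -
    have "linner Y1 (lact Y1 (lmult c) (embed y)) (elem c' x d) = lmult c \<circ> jones E\<^sub>A (lip (y \<lhd> d) x) (star c')"
      using T2.linner_lact[OF _ embed_in[OF y] elem_in[OF x]] L.lmult_in embed_linner_elem[OF y x] by simp
    also have "\<dots> = jones E\<^sub>A (lip ((c \<rhd> y) \<lhd> d) x) (star c')"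
      using y X_subset[OF x] by (intro ext) (simp add: jones_apply lmult_def act_assoc lip_lact mult.assoc)
    finally show ?thesis using y by (simp add: embed_linner_elem x)
  qed
qed (simp add: embed_in y)

lemma embed_ract:
  assumes y: "y \<in> carrier"
  shows "embed (y \<lhd> d) = ract Y1 (embed y) (lmult d)"
proof (rule eq_by_linner)
  show "ract Y1 (embed y) (lmult d) \<in> carrier1"
    using T2.ract_in embed_in[OF y] R.lmult_in by simp
  show "linner Y1 (embed (y \<lhd> d)) (elem c x d') = linner Y1 (ract Y1 (embed y) (lmult d)) (elem c x d')"
    if x: "x \<in> X" for c x d'
  proof -
    have "linner Y1 (ract Y1 (embed y) (lmult d)) (elem c x d') = linner Y1 (embed y) (elem c x (d * d'))"
      using T2.linner_ract[OF _ embed_in[OF y] elem_in[OF x], of "lmult d" c d'] R.lmult_in x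
      by (simp add: R.adjoint_lmult elem_ract star_star) (simp add: lmult_def)
    then show ?thesis using y by (simp add: embed_linner_elem x ract_mult)
  qed
qed (simp add: embed_in y)

subsection \<open>The dual expectation\<close>

text \<open>If \<open>E\<^sup>Y\<close> is to satisfy \<open>E\<^sup>C(\<langle>\<xi>, \<phi>(z)\<rangle>) = \<langle>E\<^sup>Y \<xi>, z\<rangle>\<close>, a frame of pairs \<open>(z, x)\<close> forces
\<open>E\<^sup>Y \<xi> = \<Sum> E\<^sup>Y \<xi>\<cdot>\<langle>z, x\<rangle> = \<Sum> E\<^sup>C(\<langle>\<xi>, \<phi>(z)\<rangle>)\<cdot>x\<close>. This map is defined on all of \<open>Y\<^sub>1\<close>, so there is
no question of well-definedness, and its values on elementary tensors follow from
\<open>elem_linner_embed\<close>.\<close>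

lemma dual_bimodule_expectation_exists:
  "\<exists>F. clinear_on carrier1 F \<and> F ` carrier1 \<subseteq> carrier \<and>
     (\<forall>c d. \<forall>x\<in>X. F (elem c x d) = L.index_inv \<rhd> (c \<rhd> x) \<lhd> star d)"
proof -
  obtain ps where ps: "set ps \<subseteq> carrier \<times> X" "(\<Sum>p\<leftarrow>ps. rip (fst p) (snd p)) = 1"
    using right_frame by blast
  note mem = frame_mem[OF ps(1)]
  define F where "F \<xi> = (\<Sum>p\<leftarrow>ps. dual_expectation E\<^sub>A (linner Y1 \<xi> (embed (fst p))) \<rhd> snd p)" for \<xi>
  have "clinear_on carrier1 F"
    unfolding F_def
  proof (rule clinear_on_sum_of)
    fix p assume p: "p \<in> set ps"
    have "clinear_on carrier1 (\<lambda>\<xi>. dual_expectation E\<^sub>A (linner Y1 \<xi> (embed (fst p))))"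
      by (rule clinear_on_compose[OF T2.linner_linear L.dual_expectation_linear])
        (use T2.linner_in embed_in mem[OF p] in auto)
    then show "clinear_on carrier1 (\<lambda>\<xi>. dual_expectation E\<^sub>A (linner Y1 \<xi> (embed (fst p))) \<rhd> snd p)"
      using Y.lact_linear_alg[OF mem(3)[OF p]] by (rule clinear_on_compose) simp
  qed
  moreover have "F ` carrier1 \<subseteq> carrier"
    unfolding F_def using mem by (auto intro!: csubspace_sum_list Y.carrier_subspace)
  moreover have "F (elem c x d) = L.index_inv \<rhd> (c \<rhd> x) \<lhd> star d" if x: "x \<in> X" for c x d
  proof -
    let ?y = "L.index_inv \<rhd> (c \<rhd> x) \<lhd> star d"
    note xc = X_subset[OF x]
    have "F (elem c x d) = (\<Sum>p\<leftarrow>ps. lip ?y (fst p) \<rhd> snd p)"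
      using mem xc unfolding F_def
      by (simp add: elem_linner_embed x L.dual_expectation_jones lip_lact lip_ract star_star act_assoc
          mult.assoc cong: map_cong)
    also have "\<dots> = (\<Sum>p\<leftarrow>ps. ?y \<lhd> rip (fst p) (snd p))"
      using mem xc by (simp add: imprimitivity cong: map_cong)
    also have "\<dots> = ?y \<lhd> (\<Sum>p\<leftarrow>ps. rip (fst p) (snd p))"
      using xc by (simp add: ract_sum_list_right)
    finally show ?thesis using xc by (simp add: ps(2) ract_one)
  qed
  ultimately show ?thesis by blast
qed

lemma F\<^sub>Y_linear: "clinear_on carrier1 F\<^sub>Y"
  and F\<^sub>Y_image: "F\<^sub>Y ` carrier1 \<subseteq> carrier"
  and F\<^sub>Y_elem: "x \<in> X \<Longrightarrow> F\<^sub>Y (elem c x d) = L.index_inv \<rhd> (c \<rhd> x) \<lhd> star d"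
proof -
  have "clinear_on carrier1 F\<^sub>Y \<and> F\<^sub>Y ` carrier1 \<subseteq> carrier \<and>
     (\<forall>c d. \<forall>x\<in>X. F\<^sub>Y (elem c x d) = L.index_inv \<rhd> (c \<rhd> x) \<lhd> star d)"
    unfolding F\<^sub>Y_def dual_bimodule_expectation_def L.index_inv_def[symmetric]
    by (rule someI_ex[OF dual_bimodule_expectation_exists])
  then show "clinear_on carrier1 F\<^sub>Y" "F\<^sub>Y ` carrier1 \<subseteq> carrier"
    "x \<in> X \<Longrightarrow> F\<^sub>Y (elem c x d) = L.index_inv \<rhd> (c \<rhd> x) \<lhd> star d"
    by blast+
qed

lemma F\<^sub>Y_in: "\<xi> \<in> carrier1 \<Longrightarrow> F\<^sub>Y \<xi> \<in> carrier"
  using F\<^sub>Y_image by blast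

lemma F\<^sub>Y_lact_linear: "T \<in> L.C1 \<Longrightarrow> clinear_on carrier1 (\<lambda>\<xi>. F\<^sub>Y (lact Y1 T \<xi>))"
  by (rule clinear_on_compose[OF _ F\<^sub>Y_linear]) (use T2.lact_linear T2.lact_in in simp_all)

lemma F\<^sub>Y_ract_linear: "T \<in> R.C1 \<Longrightarrow> clinear_on carrier1 (\<lambda>\<xi>. F\<^sub>Y (ract Y1 \<xi> T))"
  by (rule clinear_on_compose[OF _ F\<^sub>Y_linear]) (use T2.ract_linear T2.ract_in in simp_all)

text \<open>On the summands of \<open>\<phi>(y)\<close> the operator \<open>T\<close> replaces \<open>u\<close> by \<open>T u\<close>; the sum over \<open>v\<close> restores
\<open>u\<^sup>*\<cdot>y\<close>, which leaves \<open>w\<^sub>A\<^sup>-\<^sup>1 \<Sum> (T u) u\<^sup>*\<close>, the dual expectation of \<open>T\<close>.\<close>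

lemma F\<^sub>Y_lact_embed:
  assumes T: "T \<in> L.C1" and y: "y \<in> carrier"
  shows "F\<^sub>Y (lact Y1 T (embed y)) = dual_expectation E\<^sub>A T \<rhd> y"
proof -
  from linear_embed[OF F\<^sub>Y_lact_linear[OF T] y]
  have "F\<^sub>Y (lact Y1 T (embed y)) =
      (\<Sum>u\<leftarrow>us. \<Sum>v\<leftarrow>vs. L.index_inv \<rhd> T u \<rhd> E\<^sub>X ((star u \<rhd> y) \<lhd> v) \<lhd> star v)"
    using y by (simp add: elem_lact[OF T] F\<^sub>Y_elem E\<^sub>X_in act_assoc)
  also have "\<dots> = (\<Sum>u\<leftarrow>us. L.index_inv \<rhd> T u \<rhd> (\<Sum>v\<leftarrow>vs. E\<^sub>X ((star u \<rhd> y) \<lhd> v) \<lhd> star v))"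
    using y by (simp add: lact_sum_list)
  also have "\<dots> = dual_expectation E\<^sub>A T \<rhd> y"
    using y by (simp add: right_expansion L.dual_expectation_eq[OF T] lact_sum_list_left
        flip: lact_mult sum_list_mult_left)
  finally show ?thesis .
qed

text \<open>Here \<open>v\<close> becomes \<open>T\<^sup>* v\<close> and the sum over \<open>u\<close> restores \<open>y\<cdot>v\<close>. The factor \<open>w\<^sub>A\<^sup>-\<^sup>1\<close> is moved to the
right as \<open>w\<^sub>B\<^sup>-\<^sup>1\<close>.\<close>

lemma F\<^sub>Y_ract_embed:
  assumes T: "T \<in> R.C1" and y: "y \<in> carrier"
  shows "F\<^sub>Y (ract Y1 (embed y) T) = y \<lhd> dual_expectation E\<^sub>B T"
proof -
  let ?S = "adjoint_op E\<^sub>B T"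
  from linear_embed[OF F\<^sub>Y_ract_linear[OF T] y]
  have "F\<^sub>Y (ract Y1 (embed y) T) =
      (\<Sum>u\<leftarrow>us. \<Sum>v\<leftarrow>vs. L.index_inv \<rhd> (u \<rhd> E\<^sub>X ((star u \<rhd> y) \<lhd> v)) \<lhd> star (?S v))"
    using y by (simp add: elem_ract[OF T] F\<^sub>Y_elem E\<^sub>X_in)
  also have "\<dots> = (\<Sum>v\<leftarrow>vs. L.index_inv \<rhd> (\<Sum>u\<leftarrow>us. u \<rhd> E\<^sub>X (star u \<rhd> (y \<lhd> v))) \<lhd> star (?S v))"
    using y by (subst sum_list_swap) (simp add: lact_sum_list ract_sum_list act_assoc)
  also have "\<dots> = (\<Sum>v\<leftarrow>vs. y \<lhd> (R.index_inv * (v * star (?S v))))"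
  proof -
    have "L.index_inv \<rhd> y \<lhd> v \<lhd> s = y \<lhd> (R.index_inv * (v * s))" for v s
      using y by (simp add: index_inv_intertwined R.index_inv_central mult.assoc flip: ract_mult)
    then show ?thesis by (simp only: left_expansion[OF ract_in[OF y]])
  qed
  also have "\<dots> = y \<lhd> dual_expectation E\<^sub>B T"
    using y by (simp add: R.dual_expectation_adjoint[OF T] ract_sum_list_right flip: sum_list_mult_left)
  finally show ?thesis .
qed

lemma F\<^sub>Y_embed: "y \<in> carrier \<Longrightarrow> F\<^sub>Y (embed y) = y"
proof -
  assume y: "y \<in> carrier"
  have "lmult 1 = (id :: 'c \<Rightarrow> 'c)" by (rule ext) (simp add: lmult_def)
  moreover have "dual_expectation E\<^sub>A (lmult 1) = 1"
    using L.lmult_in[of 1] by (simp add: L.dual_expectation_eq lmult_def L.index_inv_left flip: L.index_def)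
  ultimately show ?thesis
    using F\<^sub>Y_lact_embed[OF L.lmult_in[of 1] y] T2.lact_one[OF embed_in[OF y]] y
    by (simp add: lact_one)
qed

lemma F\<^sub>Y_lact:
  assumes "\<xi> \<in> carrier1"
  shows "F\<^sub>Y (lact Y1 (lmult c) \<xi>) = c \<rhd> F\<^sub>Y \<xi>"
proof (rule linear_eq_on_elem[of "\<lambda>\<xi>. F\<^sub>Y (lact Y1 (lmult c) \<xi>)" "\<lambda>\<xi>. c \<rhd> F\<^sub>Y \<xi>"])
  show "clinear_on carrier1 (\<lambda>\<xi>. F\<^sub>Y (lact Y1 (lmult c) \<xi>))"
    by (rule F\<^sub>Y_lact_linear[OF L.lmult_in])
  show "clinear_on carrier1 (\<lambda>\<xi>. c \<rhd> F\<^sub>Y \<xi>)"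
    using Y.lact_linear[of c] F\<^sub>Y_in by (intro clinear_on_compose[OF F\<^sub>Y_linear]) simp_all
  show "F\<^sub>Y (lact Y1 (lmult c) (elem c' x d)) = c \<rhd> F\<^sub>Y (elem c' x d)" if "x \<in> X" for c' x d
  proof -
    have "L.index_inv * (c * c') = c * (L.index_inv * c')" by (metis L.index_inv_central mult.assoc)
    then show ?thesis
      using X_subset[OF that]
      by (simp add: elem_lact L.lmult_in that F\<^sub>Y_elem act_assoc) (simp add: lmult_def flip: lact_mult)
  qed
qed (rule assms)

lemma F\<^sub>Y_ract:
  assumes "\<xi> \<in> carrier1"
  shows "F\<^sub>Y (ract Y1 \<xi> (lmult d)) = F\<^sub>Y \<xi> \<lhd> d"
proof (rule linear_eq_on_elem[of "\<lambda>\<xi>. F\<^sub>Y (ract Y1 \<xi> (lmult d))" "\<lambda>\<xi>. F\<^sub>Y \<xi> \<lhd> d"])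
  show "clinear_on carrier1 (\<lambda>\<xi>. F\<^sub>Y (ract Y1 \<xi> (lmult d)))"
    by (rule F\<^sub>Y_ract_linear[OF R.lmult_in])
  show "clinear_on carrier1 (\<lambda>\<xi>. F\<^sub>Y \<xi> \<lhd> d)"
    using Y.ract_linear[of d] F\<^sub>Y_in by (intro clinear_on_compose[OF F\<^sub>Y_linear]) simp_all
  show "F\<^sub>Y (ract Y1 (elem c x d') (lmult d)) = F\<^sub>Y (elem c x d') \<lhd> d" if "x \<in> X" for c x d'
    using X_subset[OF that]
    by (simp add: elem_ract R.lmult_in R.adjoint_lmult that F\<^sub>Y_elem act_assoc)
      (simp add: lmult_def star_mult star_star ract_mult)
qed (rule assms)

text \<open>The adjoint relation between \<open>E\<^sup>Y\<close> and the embedding; both sides are linear in \<open>\<xi>\<close>, so elementary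
tensors suffice.\<close>

lemma F\<^sub>Y_linner:
  assumes y: "y \<in> carrier" and "\<xi> \<in> carrier1"
  shows "dual_expectation E\<^sub>A (linner Y1 \<xi> (embed y)) = lip (F\<^sub>Y \<xi>) y"
proof (rule linear_eq_on_elem[of "\<lambda>\<xi>. dual_expectation E\<^sub>A (linner Y1 \<xi> (embed y))" "\<lambda>\<xi>. lip (F\<^sub>Y \<xi>) y"])
  show "clinear_on carrier1 (\<lambda>\<xi>. dual_expectation E\<^sub>A (linner Y1 \<xi> (embed y)))"
    by (rule clinear_on_compose[OF T2.linner_linear L.dual_expectation_linear])
      (use T2.linner_in embed_in y in auto)
  show "clinear_on carrier1 (\<lambda>\<xi>. lip (F\<^sub>Y \<xi>) y)"
    using F\<^sub>Y_linear Y.linner_linear[OF y] F\<^sub>Y_in by (rule clinear_on_compose)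
  show "dual_expectation E\<^sub>A (linner Y1 (elem c x d) (embed y)) = lip (F\<^sub>Y (elem c x d)) y"
    if "x \<in> X" for c x d
    using y X_subset[OF that]
    by (simp add: elem_linner_embed that L.dual_expectation_jones F\<^sub>Y_elem lip_lact lip_ract act_assoc
        star_star mult.assoc)
qed (rule assms)

text \<open>The right inner product is conjugate linear in \<open>\<xi>\<close>, so the comparison on elementary tensors is made for
the starred equation. On the right-hand side \<open>w\<^sub>A\<^sup>-\<^sup>1\<close> has to be turned into \<open>w\<^sub>B\<^sup>-\<^sup>1\<close>.\<close>

lemma F\<^sub>Y_rinner:
  assumes y: "y \<in> carrier" and \<xi>: "\<xi> \<in> carrier1"
  shows "dual_expectation E\<^sub>B (rinner Y1 \<xi> (embed y)) = rip (F\<^sub>Y \<xi>) y"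
proof -
  have "dual_expectation E\<^sub>B (rinner Y1 (embed y) \<xi>) = rip y (F\<^sub>Y \<xi>)"
  proof (rule linear_eq_on_elem[of "\<lambda>\<xi>. dual_expectation E\<^sub>B (rinner Y1 (embed y) \<xi>)" "\<lambda>\<xi>. rip y (F\<^sub>Y \<xi>)"])
    show "clinear_on carrier1 (\<lambda>\<xi>. dual_expectation E\<^sub>B (rinner Y1 (embed y) \<xi>))"
      by (rule clinear_on_compose[OF T2.rinner_linear R.dual_expectation_linear])
        (use T2.rinner_in embed_in y in auto)
    show "clinear_on carrier1 (\<lambda>\<xi>. rip y (F\<^sub>Y \<xi>))"
      using F\<^sub>Y_linear Y.rinner_linear[OF y] F\<^sub>Y_in by (rule clinear_on_compose)
    show "dual_expectation E\<^sub>B (rinner Y1 (embed y) (elem c x d)) = rip y (F\<^sub>Y (elem c x d))"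
      if x: "x \<in> X" for c x d
    proof -
      note xc = X_subset[OF x]
      have "dual_expectation E\<^sub>B (rinner Y1 (embed y) (elem c x d)) = R.index_inv * rip (star c \<rhd> y) x * star d"
        using y by (simp add: embed_rinner_elem x R.dual_expectation_jones)
      also have "\<dots> = rip y (c \<rhd> x) * R.index_inv * star d"
        using y xc by (simp add: rip_lact star_star R.index_inv_central)
      also have "\<dots> = rip y ((c \<rhd> x) \<lhd> R.index_inv \<lhd> star d)"
        using y xc by (simp add: rip_ract)
      also have "(c \<rhd> x) \<lhd> R.index_inv \<lhd> star d = F\<^sub>Y (elem c x d)"
        using xc by (simp add: F\<^sub>Y_elem x act_assoc flip: index_inv_intertwined)
      finally show ?thesis .
    qed
  qed (rule \<xi>)
  then have "star (dual_expectation E\<^sub>B (rinner Y1 (embed y) \<xi>)) = rip (F\<^sub>Y \<xi>) y"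
    using y \<xi> by (simp add: rip_star F\<^sub>Y_in)
  moreover have "rinner Y1 (embed y) \<xi> \<in> R.C1" "rinner Y1 \<xi> (embed y) \<in> R.C1"
    "adjoint_op E\<^sub>B (rinner Y1 (embed y) \<xi>) = rinner Y1 \<xi> (embed y)"
    using T2.rinner_in T2.rinner_star embed_in[OF y] \<xi> by simp_all
  ultimately show ?thesis using R.dual_expectation_star by metis
qed

theorem F\<^sub>Y_conditional_expectation:
  "bimodule_conditional_expectation (range lmult) (range lmult)
     (lmult \<circ> dual_expectation E\<^sub>A) (lmult \<circ> dual_expectation E\<^sub>B)
     Y1 (embed ` carrier) (embed \<circ> F\<^sub>Y)"
  unfolding bimodule_conditional_expectation_def lalg_Y1 ralg_Y1
proof (intro conjI ballI)
  show "clinear_on carrier1 (embed \<circ> F\<^sub>Y)"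
    unfolding comp_def by (rule clinear_on_compose[OF F\<^sub>Y_linear embed_linear F\<^sub>Y_in])
  show "(embed \<circ> F\<^sub>Y) ` carrier1 = embed ` carrier"
  proof
    show "(embed \<circ> F\<^sub>Y) ` carrier1 \<subseteq> embed ` carrier" using F\<^sub>Y_in by auto
    show "embed ` carrier \<subseteq> (embed \<circ> F\<^sub>Y) ` carrier1"
    proof
      fix \<eta> assume "\<eta> \<in> embed ` carrier"
      then obtain y where "\<eta> = embed y" "y \<in> carrier" by blast
      then show "\<eta> \<in> (embed \<circ> F\<^sub>Y) ` carrier1"
        by (intro image_eqI[of _ _ "embed y"]) (simp_all add: F\<^sub>Y_embed embed_in)
    qed
  qed
next
  fix T \<eta> assume T: "T \<in> L.C1" and "\<eta> \<in> embed ` carrier"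
  then obtain y where y: "\<eta> = embed y" "y \<in> carrier" by blast
  then show "(embed \<circ> F\<^sub>Y) (lact Y1 T \<eta>) = lact Y1 ((lmult \<circ> dual_expectation E\<^sub>A) T) \<eta>"
    by (simp add: F\<^sub>Y_lact_embed T embed_lact)
next
  fix a :: "'c \<Rightarrow> 'c" and \<xi> assume "a \<in> range lmult" and \<xi>: "\<xi> \<in> carrier1"
  then obtain c where "a = lmult c" by blast
  then show "(embed \<circ> F\<^sub>Y) (lact Y1 a \<xi>) = lact Y1 a ((embed \<circ> F\<^sub>Y) \<xi>)"
    by (simp add: F\<^sub>Y_lact embed_lact F\<^sub>Y_in \<xi>)
next
  fix \<xi> \<eta> assume \<xi>: "\<xi> \<in> carrier1" and "\<eta> \<in> embed ` carrier"
  then obtain y where y: "\<eta> = embed y" "y \<in> carrier" by blast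
  then show "(lmult \<circ> dual_expectation E\<^sub>A) (linner Y1 \<xi> \<eta>) = linner Y1 ((embed \<circ> F\<^sub>Y) \<xi>) \<eta>"
    by (simp add: F\<^sub>Y_linner embed_linner F\<^sub>Y_in \<xi>)
next
  fix T \<eta> assume T: "T \<in> R.C1" and "\<eta> \<in> embed ` carrier"
  then obtain y where y: "\<eta> = embed y" "y \<in> carrier" by blast
  then show "(embed \<circ> F\<^sub>Y) (ract Y1 \<eta> T) = ract Y1 \<eta> ((lmult \<circ> dual_expectation E\<^sub>B) T)"
    by (simp add: F\<^sub>Y_ract_embed T embed_ract)
next
  fix b :: "'d \<Rightarrow> 'd" and \<xi> assume "b \<in> range lmult" and \<xi>: "\<xi> \<in> carrier1"
  then obtain d where "b = lmult d" by blast
  then show "(embed \<circ> F\<^sub>Y) (ract Y1 \<xi> b) = ract Y1 ((embed \<circ> F\<^sub>Y) \<xi>) b"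
    by (simp add: F\<^sub>Y_ract embed_ract F\<^sub>Y_in \<xi>)
next
  fix \<xi> \<eta> assume \<xi>: "\<xi> \<in> carrier1" and "\<eta> \<in> embed ` carrier"
  then obtain y where y: "\<eta> = embed y" "y \<in> carrier" by blast
  then show "(lmult \<circ> dual_expectation E\<^sub>B) (rinner Y1 \<xi> \<eta>) = rinner Y1 ((embed \<circ> F\<^sub>Y) \<xi>) \<eta>"
    by (simp add: F\<^sub>Y_rinner embed_rinner F\<^sub>Y_in \<xi>)
qed

end

theorem lemma6p4:
  fixes A :: "'c::cstar_algebra set" and B :: "'d::cstar_algebra set"
    and Y :: "('c, 'd, 'y::complex_vector) bimodule" and X :: "'y set"
    and E\<^sub>A :: "'c \<Rightarrow> 'c" and E\<^sub>B :: "'d \<Rightarrow> 'd" and E\<^sub>X :: "'y \<Rightarrow> 'y"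
    and us :: "'c list" and vs :: "'d list"
    and Z :: "('c \<Rightarrow> 'c, 'd, 'z::complex_vector) bimodule" and t1 :: "'c \<Rightarrow> 'y \<Rightarrow> 'z"
    and Y1 :: "('c \<Rightarrow> 'c, 'd \<Rightarrow> 'd, 'w::complex_vector) bimodule" and t2 :: "'z \<Rightarrow> 'd conj \<Rightarrow> 'w"
    and t :: "'c \<Rightarrow> 'y \<Rightarrow> 'd \<Rightarrow> 'w" and \<phi> :: "'y \<Rightarrow> 'w" and E\<^sub>Y :: "'w \<Rightarrow> 'y"
  assumes "unital_cstar_subalgebra A" and "unital_cstar_subalgebra B"
    and "strongly_morita_equivalent A B Y X"
    and "conditional_expectation A E\<^sub>A" and "conditional_expectation B E\<^sub>B"
    and "quasi_basis E\<^sub>A us" and "quasi_basis E\<^sub>B vs"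
    and "bimodule_conditional_expectation A B E\<^sub>A E\<^sub>B Y X E\<^sub>X"
    and "is_tensor_product (basic_bimodule A E\<^sub>A) (sub_bimodule Y A B X) Z t1"
    and "is_tensor_product Z (dual_bimodule (basic_bimodule B E\<^sub>B)) Y1 t2"
  defines "t \<equiv> \<lambda>c x d. t2 (t1 c x) (tilde d)"
    and "\<phi> \<equiv> upward_embedding Y E\<^sub>X t us vs"
    and "E\<^sub>Y \<equiv> dual_bimodule_expectation E\<^sub>A Y X Y1 t"
  shows "bimodule_conditional_expectation (range lmult) (range lmult)
           (lmult \<circ> dual_expectation E\<^sub>A) (lmult \<circ> dual_expectation E\<^sub>B)
           Y1 (\<phi> ` bcar Y) (\<phi> \<circ> E\<^sub>Y)"
proof -
  interpret basic_construction_bimodule A E\<^sub>A us B E\<^sub>B vs Y X E\<^sub>X Z t1 Y1 t2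
    by unfold_locales (fact assms)+
  have "elem = t" by (intro ext) (simp add: elem_def t_def)
  then show ?thesis
    using F\<^sub>Y_conditional_expectation by (simp add: embed_def F\<^sub>Y_def \<phi>_def E\<^sub>Y_def)
qed

end
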